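(* For any $\epsilon,\zeta>0$ there are $\eta>0$ and $J\in\mathbb{N}$ such that the following holds for any $p,\rho\in[\zeta,1-\zeta]$ and $\lambda\in[\zeta,1]$. If $f\colon\{0,1\}^n\to[0,1]$ and $g\colon\{0,1\}^n\to\{0,1\}$ are one-sided error solutions with $\lambda$ and error $\eta$, then $g$ is $\epsilon$-close (under $\mu_p$) to a monotone Boolean function depending on at most $J$ coordinates.
   Context: $\mu_q$ is the $q$-biased product measure on $\{0,1\}^n$; $\mathrm{T}^{p}_{\rho p}f(x)=\mathbb{E}_{\mathbf{z}\sim\mu_\rho}[f(x\wedge\mathbf{z})]$ (coordinatewise AND). $f,g$ are called one-sided error solutions with $\lambda>0$ and error $\eta$ if (1) $\mathbb{E}_{\mathbf{x}\sim\mu_p}[(1-g(\mathbf{x}))\cdot\mathrm{T}^{p}_{\rho p}f(\mathbf{x})]\le\eta$, and (2) $\Pr_{\mathbf{x}\sim\mu_p}[g(\mathbf{x})=1,\ \mathrm{T}^{p}_{\rho p}f(\mathbf{x})\le\lambda]\le\eta$. $\epsilon$-close means $\Pr_{\mathbf{x}\sim\mu_p}[g(\mathbf{x})\ne h(\mathbf{x})]\le\epsilon$. *)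

theory Defs
  imports "HOL-Probability.Probability"
begin

text \<open>
  The dimension \<open>n\<close> is a natural number bound after the constants in the theorem, so it is not a
  type index. A point of \<open>{0,1}^n\<close> is a function \<^typ>\<open>nat \<Rightarrow> bool\<close> that is \<^const>\<open>False\<close> outside
  \<open>{..<n}\<close>; Boolean functions take values in \<^typ>\<open>bool\<close>.
\<close>

definition cube :: "nat \<Rightarrow> (nat \<Rightarrow> bool) set" where
  "cube n = {x. \<forall>i\<ge>n. \<not> x i}"

definition biased :: "nat \<Rightarrow> real \<Rightarrow> (nat \<Rightarrow> bool) pmf" where
  "biased n q = Pi_pmf {..<n} False (\<lambda>_. bernoulli_pmf q)"

text \<open>
  The operator \<open>T\<^sup>p\<^bsub>\<rho>p\<^esub>\<close>. The parameter \<open>p\<close> only records that it maps functions on the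
  \<open>\<rho>p\<close>-biased cube to functions on the \<open>p\<close>-biased cube; the values depend on \<open>\<rho>\<close> alone.
\<close>

definition and_op :: "nat \<Rightarrow> real \<Rightarrow> ((nat \<Rightarrow> bool) \<Rightarrow> real) \<Rightarrow> (nat \<Rightarrow> bool) \<Rightarrow> real" where
  "and_op n \<rho> f x = measure_pmf.expectation (biased n \<rho>) (\<lambda>z. f (\<lambda>i. x i \<and> z i))"

definition one_sided_error_solutions ::
  "nat \<Rightarrow> real \<Rightarrow> real \<Rightarrow> real \<Rightarrow> real \<Rightarrow> ((nat \<Rightarrow> bool) \<Rightarrow> real) \<Rightarrow> ((nat \<Rightarrow> bool) \<Rightarrow> bool) \<Rightarrow> bool" where
  "one_sided_error_solutions n p \<rho> lam \<eta> f g \<longleftrightarrow>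
     lam > 0 \<and>
     measure_pmf.expectation (biased n p) (\<lambda>x. (1 - of_bool (g x)) * and_op n \<rho> f x) \<le> \<eta> \<and>
     measure_pmf.prob (biased n p) {x. g x \<and> and_op n \<rho> f x \<le> lam} \<le> \<eta>"

definition close ::
  "nat \<Rightarrow> real \<Rightarrow> real \<Rightarrow> ((nat \<Rightarrow> bool) \<Rightarrow> bool) \<Rightarrow> ((nat \<Rightarrow> bool) \<Rightarrow> bool) \<Rightarrow> bool" where
  "close n p \<epsilon> g h \<longleftrightarrow> measure_pmf.prob (biased n p) {x. g x \<noteq> h x} \<le> \<epsilon>"

definition depends_on_at_most :: "nat \<Rightarrow> nat \<Rightarrow> ((nat \<Rightarrow> bool) \<Rightarrow> bool) \<Rightarrow> bool" where
  "depends_on_at_most n J h \<longleftrightarrow>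
     (\<exists>S \<subseteq> {..<n}. card S \<le> J \<and>
        (\<forall>x\<in>cube n. \<forall>y\<in>cube n. (\<forall>i\<in>S. x i = y i) \<longrightarrow> h x = h y))"

end

theory Submission imports Defs begin

text \<open>
  Write \<open>u = T\<^sub>\<rho> f\<close>. Up to probability \<open>O(\<eta>)\<close>, \<open>g = 1\<close> forces \<open>u > \<lambda>\<close> while \<open>g = 0\<close> forces \<open>u\<close> to be
  tiny, so \<open>g\<close> can only change where \<open>u\<close> jumps across a gap of constant size. Split
  \<open>T\<^sub>\<rho> = T\<^sub>\<sigma> T\<^sub>\<sigma>\<close> with \<open>\<sigma> = sqrt \<rho>\<close> and put \<open>v = T\<^sub>\<sigma> f\<close>. Smoothing bounds the total influence of \<open>v\<close> by a
  constant \<open>K\<close>; let \<open>J\<close> be the at most \<open>K / \<tau>\<close> coordinates of influence more than \<open>\<tau>\<close>.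
  The other coordinates are grouped into boundedly many blocks \<open>B\<close> of influence \<open>W\<^sub>B \<le> 2 \<tau>\<close>. Small-set
  expansion of \<open>T\<^sub>\<sigma>\<close> shows that resampling \<open>B\<close> makes \<open>u\<close> jump with probability only
  \<open>O(\<tau>\<^sup>\<delta>) W\<^sub>B\<close>, which sums to \<open>O(\<tau>\<^sup>\<delta>) K\<close> over the blocks. Hence
  \<open>g\<close> is close to \<open>x \<mapsto> g (x\<^sub>J, y)\<close> for most \<open>y\<close>. Finally \<open>u\<close> loses at most a factor \<open>1 - \<rho>\<close> when a
  coordinate is raised, so because of the gap \<open>x\<^sub>J \<mapsto> g (x\<^sub>J, y)\<close> is monotone as soon as no point
  \<open>(x\<^sub>J, y)\<close> is exceptional, and this holds for most \<open>y\<close> since \<open>J\<close> has bounded size.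
\<close>

section \<open>Averaging and thinning operators\<close>

text \<open>
  \<open>avg p S\<close> is the expectation over \<open>p\<close>-biased resampling of the coordinates in \<open>S\<close>, and \<open>thin \<rho> S\<close> is
  the paper's \<open>T\<close> acting on the coordinates in \<open>S\<close>; both are the identity for infinite \<open>S\<close>.
\<close>

definition avg1 :: "real \<Rightarrow> 'a \<Rightarrow> (('a \<Rightarrow> bool) \<Rightarrow> real) \<Rightarrow> ('a \<Rightarrow> bool) \<Rightarrow> real" where
  "avg1 p i F = (\<lambda>x. p * F (x(i := True)) + (1 - p) * F (x(i := False)))"

definition thin1 :: "real \<Rightarrow> 'a \<Rightarrow> (('a \<Rightarrow> bool) \<Rightarrow> real) \<Rightarrow> ('a \<Rightarrow> bool) \<Rightarrow> real" where
  "thin1 \<rho> i F = (\<lambda>x. \<rho> * F x + (1 - \<rho>) * F (x(i := False)))"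

definition avg :: "real \<Rightarrow> 'a set \<Rightarrow> (('a \<Rightarrow> bool) \<Rightarrow> real) \<Rightarrow> ('a \<Rightarrow> bool) \<Rightarrow> real" where
  "avg p S F = Finite_Set.fold (avg1 p) F S"

definition thin :: "real \<Rightarrow> 'a set \<Rightarrow> (('a \<Rightarrow> bool) \<Rightarrow> real) \<Rightarrow> ('a \<Rightarrow> bool) \<Rightarrow> real" where
  "thin \<rho> S F = Finite_Set.fold (thin1 \<rho>) F S"

text \<open>Commutation makes the value of \<open>Finite_Set.fold\<close> in \<open>avg\<close>
  independent of the order in which the coordinates are processed.\<close>

lemma comp_fun_commute_avg1: "comp_fun_commute (avg1 p)"
proof
  fix i j :: 'a
  show "avg1 p j \<circ> avg1 p i = avg1 p i \<circ> avg1 p j"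
    by (cases "i = j") (auto simp: fun_eq_iff avg1_def fun_upd_twist algebra_simps)
qed

lemma comp_fun_commute_thin1: "comp_fun_commute (thin1 \<rho>)"
proof
  fix i j :: 'a
  show "thin1 \<rho> j \<circ> thin1 \<rho> i = thin1 \<rho> i \<circ> thin1 \<rho> j"
    by (cases "i = j") (auto simp: fun_eq_iff thin1_def fun_upd_twist algebra_simps)
qed

lemma avg_empty [simp]: "avg p {} F = F"
  by (simp add: avg_def)

lemma thin_empty [simp]: "thin \<rho> {} F = F"
  by (simp add: thin_def)

lemma avg_infinite: "infinite S \<Longrightarrow> avg p S F = F"
  by (simp add: avg_def)

lemma thin_infinite: "infinite S \<Longrightarrow> thin \<rho> S F = F"
  by (simp add: thin_def)

lemma avg_insert:
  fixes S :: "'a set"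
  shows "finite S \<Longrightarrow> i \<notin> S \<Longrightarrow> avg p (insert i S) F = avg1 p i (avg p S F)"
proof -
  interpret comp_fun_commute "avg1 p :: 'a \<Rightarrow> _"
    by (rule comp_fun_commute_avg1)
  show "finite S \<Longrightarrow> i \<notin> S \<Longrightarrow> avg p (insert i S) F = avg1 p i (avg p S F)"
    by (simp add: avg_def)
qed

lemma thin_insert:
  fixes S :: "'a set"
  shows "finite S \<Longrightarrow> i \<notin> S \<Longrightarrow> thin \<rho> (insert i S) F = thin1 \<rho> i (thin \<rho> S F)"
proof -
  interpret comp_fun_commute "thin1 \<rho> :: 'a \<Rightarrow> _"
    by (rule comp_fun_commute_thin1)
  show "finite S \<Longrightarrow> i \<notin> S \<Longrightarrow> thin \<rho> (insert i S) F = thin1 \<rho> i (thin \<rho> S F)"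
    by (simp add: thin_def)
qed

lemma avg_upd: "i \<notin> S \<Longrightarrow> avg p S F (x(i := b)) = avg p S (\<lambda>y. F (y(i := b))) x"
proof (induction S arbitrary: x rule: infinite_finite_induct)
  case (insert k S)
  have *: "avg p S F (x(i := b, k := c)) = avg p S (\<lambda>y. F (y(i := b))) (x(k := c))" for c
    using insert.prems insert.IH[of "x(k := c)"] fun_upd_twist[of i k x b c] by (metis insertCI)
  show ?case
    by (simp only: avg_insert[OF insert.hyps] avg1_def *)
qed (simp_all add: avg_infinite)

lemma thin_upd: "i \<notin> S \<Longrightarrow> thin \<rho> S F (x(i := b)) = thin \<rho> S (\<lambda>y. F (y(i := b))) x"
proof (induction S arbitrary: x rule: infinite_finite_induct)
  case (insert k S)
  have *: "thin \<rho> S F (x(i := b, k := c)) = thin \<rho> S (\<lambda>y. F (y(i := b))) (x(k := c))" for c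
    using insert.prems insert.IH[of "x(k := c)"] fun_upd_twist[of i k x b c] by (metis insertCI)
  have **: "thin \<rho> S F (x(i := b)) = thin \<rho> S (\<lambda>y. F (y(i := b))) x"
    using insert.prems by (intro insert.IH) simp
  show ?case
    by (simp only: thin_insert[OF insert.hyps] thin1_def * **)
qed (simp_all add: thin_infinite)

text \<open>The energy, variance and small-set inductions use this form: each restriction of
  \<open>F\<close> at \<open>i\<close> is averaged over \<open>S\<close> alone, so the induction
  hypothesis applies to it.\<close>

lemma avg_insert_slices:
  assumes "finite S" "i \<notin> S"
  shows "avg p (insert i S) F x =
    p * avg p S (\<lambda>y. F (y(i := True))) x + (1 - p) * avg p S (\<lambda>y. F (y(i := False))) x"
  using assms by (simp add: avg_insert avg1_def avg_upd)

lemma avg_add: "avg p S (\<lambda>x. F x + G x) x = avg p S F x + avg p S G x"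
  by (induction S arbitrary: x rule: infinite_finite_induct)
     (simp_all add: avg_infinite avg_insert avg1_def algebra_simps)

lemma avg_cmult: "avg p S (\<lambda>x. c * F x) x = c * avg p S F x"
  by (induction S arbitrary: x rule: infinite_finite_induct)
     (simp_all add: avg_infinite avg_insert avg1_def algebra_simps)

lemma avg_diff: "avg p S (\<lambda>x. F x - G x) x = avg p S F x - avg p S G x"
  using avg_add[of p S F "\<lambda>x. -1 * G x"] by (simp only: avg_cmult) simp

lemma avg_const: "avg p S (\<lambda>x. c) x = c"
  by (induction S arbitrary: x rule: infinite_finite_induct)
     (simp_all add: avg_infinite avg_insert avg1_def algebra_simps)

lemma avg_sum: "avg p S (\<lambda>x. \<Sum>i\<in>I. F i x) x = (\<Sum>i\<in>I. avg p S (F i) x)"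
  by (induction I rule: infinite_finite_induct) (simp_all add: avg_const avg_add)

lemma thin_add: "thin \<rho> S (\<lambda>x. F x + G x) x = thin \<rho> S F x + thin \<rho> S G x"
  by (induction S arbitrary: x rule: infinite_finite_induct)
     (simp_all add: thin_infinite thin_insert thin1_def algebra_simps)

lemma thin_cmult: "thin \<rho> S (\<lambda>x. c * F x) x = c * thin \<rho> S F x"
  by (induction S arbitrary: x rule: infinite_finite_induct)
     (simp_all add: thin_infinite thin_insert thin1_def algebra_simps)

lemma thin_diff: "thin \<rho> S (\<lambda>x. F x - G x) x = thin \<rho> S F x - thin \<rho> S G x"
  using thin_add[of \<rho> S F "\<lambda>x. -1 * G x"] by (simp only: thin_cmult) simp

lemma avg_mono:
  assumes "0 \<le> p" "p \<le> 1" "\<And>x. F x \<le> G x"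
  shows "avg p S F x \<le> avg p S G x"
  by (induction S arbitrary: x rule: infinite_finite_induct)
     (use assms in \<open>auto simp: avg_infinite avg_insert avg1_def intro!: add_mono mult_left_mono\<close>)

lemma thin_mono:
  assumes "0 \<le> \<rho>" "\<rho> \<le> 1" "\<And>x. F x \<le> G x"
  shows "thin \<rho> S F x \<le> thin \<rho> S G x"
  by (induction S arbitrary: x rule: infinite_finite_induct)
     (use assms in \<open>auto simp: thin_infinite thin_insert thin1_def intro!: add_mono mult_left_mono\<close>)

lemma avg_nonneg:
  assumes "0 \<le> p" "p \<le> 1" "\<And>x. 0 \<le> F x"
  shows "0 \<le> avg p S F x"
  using avg_mono[OF assms(1,2), of "\<lambda>_. 0" F] assms(3) by (simp add: avg_const)

lemma abs_thin_le:
  assumes "0 \<le> \<rho>" "\<rho> \<le> 1"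
  shows "\<bar>thin \<rho> S F x\<bar> \<le> thin \<rho> S (\<lambda>x. \<bar>F x\<bar>) x"
proof -
  have "thin \<rho> S (\<lambda>x. -1 * F x) x \<le> thin \<rho> S (\<lambda>x. \<bar>F x\<bar>) x"
    "thin \<rho> S F x \<le> thin \<rho> S (\<lambda>x. \<bar>F x\<bar>) x"
    by (intro thin_mono assms; simp)+
  then show ?thesis
    unfolding thin_cmult by linarith
qed

section \<open>Iterated averages and their interaction with thinning\<close>

lemma avg_union:
  assumes "finite S" "finite T" "S \<inter> T = {}"
  shows "avg p (S \<union> T) F = avg p S (avg p T F)"
  using assms by (induction S rule: finite_induct) (simp_all add: avg_insert)

lemma avg_commute_avg:
  "avg p S (\<lambda>x. avg q T (\<lambda>y. H x y) z) w = avg q T (\<lambda>y. avg p S (\<lambda>x. H x y) w) z"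
  by (induction S arbitrary: w rule: infinite_finite_induct)
     (simp_all add: avg_infinite avg_insert avg1_def avg_add avg_cmult)

lemma avg_upd_inside:
  assumes "finite S" "i \<in> S"
  shows "avg p S F (x(i := b)) = avg p S F x"
proof -
  obtain T where "S = insert i T" "i \<notin> T" "finite T"
    using assms by (metis finite_insert mk_disjoint_insert)
  then show ?thesis
    by (simp add: avg_insert avg1_def)
qed

lemma avg_mult_left:
  assumes "\<And>i x b. i \<in> S \<Longrightarrow> F (x(i := b)) = F x"
  shows "avg p S (\<lambda>x. F x * G x) x = F x * avg p S G x"
  using assms
  by (induction S arbitrary: x rule: infinite_finite_induct)
     (simp_all add: avg_infinite avg_insert avg1_def algebra_simps)

lemma avg_invariant:
  assumes "\<And>i x b. i \<in> S \<Longrightarrow> F (x(i := b)) = F x"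
  shows "avg p S F x = F x"
  using avg_mult_left[of S F p "\<lambda>_. 1"] assms by (simp add: avg_const)

text \<open>Tower property: split the average over \<open>U\<close> into one over
  \<open>U - B\<close> of one over \<open>B\<close>; the second average over \<open>B\<close> then
  sees a function that is constant along \<open>B\<close>.\<close>

lemma avg_avg_subset:
  assumes "finite U" "B \<subseteq> U"
  shows "avg p U (avg p B F) x = avg p U F x"
proof -
  have fin: "finite B" "finite (U - B)" using assms finite_subset by auto
  have U: "(U - B) \<union> B = U" using assms by auto
  have "avg p U G = avg p (U - B) (avg p B G)" for G
    using avg_union[OF fin(2,1)] U by (metis Diff_disjoint inf_commute)
  moreover have "avg p B (avg p B F) = avg p B F"
    using fin avg_upd_inside by (intro ext avg_invariant avg_upd_inside) auto
  ultimately show ?thesis by simp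
qed

text \<open>The AND of a \<open>p\<close>-biased bit with an independent
  \<open>\<rho>\<close>-biased bit is \<open>\<rho> * p\<close>-biased.\<close>

lemma avg1_thin1: "avg1 p i (thin1 \<rho> i F) = avg1 (\<rho> * p) i F"
  by (simp add: avg1_def thin1_def fun_eq_iff algebra_simps)

lemma thin1_avg1: "thin1 \<rho> i (avg1 q i F) = avg1 q i F"
  by (simp add: avg1_def thin1_def fun_eq_iff algebra_simps)

lemma avg1_thin1_neq: "i \<noteq> k \<Longrightarrow> avg1 q i (thin1 \<rho> k F) = thin1 \<rho> k (avg1 q i F)"
  by (simp add: avg1_def thin1_def fun_eq_iff fun_upd_twist algebra_simps)

lemma avg1_thin:
  assumes "finite U" "i \<in> U"
  shows "avg1 p i (thin \<rho> U F) = thin \<rho> U (avg1 (\<rho> * p) i F)"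
proof -
  obtain T where T: "U = insert i T" "i \<notin> T" "finite T"
    using assms by (metis finite_insert mk_disjoint_insert)
  have "avg1 q i (thin \<rho> T F) = thin \<rho> T (avg1 q i F)" for q
    using T(3,2) by (induction T rule: finite_induct) (simp_all add: thin_insert avg1_thin1_neq)
  from this[symmetric] show ?thesis
    using T by (simp add: thin_insert avg1_thin1 thin1_avg1)
qed

text \<open>Through this, the deviation of \<open>thin \<rho> U F\<close> from its block average is
  the thinning of a deviation of \<open>F\<close>, taken at bias \<open>\<rho> * p\<close>.\<close>

lemma avg_thin:
  assumes "finite U" "B \<subseteq> U"
  shows "avg p B (thin \<rho> U F) = thin \<rho> U (avg (\<rho> * p) B F)"
proof -
  have "finite B" using assms finite_subset by auto
  then show ?thesis
    using assms by (induction B rule: finite_induct) (simp_all add: avg_insert avg1_thin)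
qed

text \<open>A bit that survives two independent rounds with probability \<open>\<sigma>\<close> each
  survives with probability \<open>\<sigma> * \<sigma>\<close>; used with
  \<open>\<sigma> = sqrt \<rho>\<close> to factor the operator.\<close>

lemma thin_thin:
  "thin \<sigma> S (thin \<sigma> S F) = thin (\<sigma> * \<sigma>) S F"
proof (induction S arbitrary: F rule: infinite_finite_induct)
  case (insert k S)
  have "thin \<sigma> S (thin1 \<sigma> k G) = thin1 \<sigma> k (thin \<sigma> S G)" for G
    using insert(1)
  proof (induction S rule: finite_induct)
    case (insert i S)
    have "thin1 \<sigma> i (thin1 \<sigma> k H) = thin1 \<sigma> k (thin1 \<sigma> i H)" for H
      using comp_fun_commute.comp_fun_commute[OF comp_fun_commute_thin1, of \<sigma> k i]
      by (simp add: fun_eq_iff)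
    with insert show ?case
      by (simp add: thin_insert)
  qed simp
  then show ?case
    using insert by (simp add: thin_insert) (simp add: thin1_def fun_eq_iff algebra_simps)
qed (simp_all add: thin_infinite)

section \<open>Influences\<close>

text \<open>The influence of \<open>i\<close> is the average of the square of this, without the
  customary factor \<open>q * (1 - q)\<close>.\<close>

definition cdiff :: "'a \<Rightarrow> (('a \<Rightarrow> bool) \<Rightarrow> real) \<Rightarrow> ('a \<Rightarrow> bool) \<Rightarrow> real" where
  "cdiff i F = (\<lambda>x. F (x(i := True)) - F (x(i := False)))"

text \<open>Induction on coordinates. Thinning \<open>k\<close> mixes the two restrictions of
  \<open>f\<close>; the exact loss of squared norm in this mixing,
  \<open>\<rho> * (1 - \<rho>)\<close> times that of their difference, pays for the influence of
  \<open>k\<close>. The result bounds the total influence of a smoothed function.\<close>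

lemma thin_energy:
  assumes "finite U" and p: "0 \<le> p" "p \<le> 1" and \<rho>: "0 \<le> \<rho>" "\<rho> \<le> 1"
  shows "avg p U (\<lambda>x. (thin \<rho> U f x)\<^sup>2) x
      + p * (1 - \<rho>) * (\<Sum>i\<in>U. avg p U (\<lambda>x. (cdiff i (thin \<rho> U f) x)\<^sup>2) x)
    \<le> avg (\<rho> * p) U (\<lambda>x. (f x)\<^sup>2) x"
  using \<open>finite U\<close>
proof (induction U arbitrary: f rule: finite_induct)
  case (insert k U)
  define f1 where "f1 = (\<lambda>y. f (y(k := True)))"
  define f0 where "f0 = (\<lambda>y. f (y(k := False)))"
  define fm where "fm = (\<lambda>y. \<rho> * f1 y + (1 - \<rho>) * f0 y)"
  define fd where "fd = (\<lambda>y. f1 y - f0 y)"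
  define T where "T = thin \<rho> (insert k U) f"
  have T1: "T (y(k := True)) = thin \<rho> U fm y" for y
    using insert(1,2)
    by (simp add: T_def thin_insert thin1_def thin_upd fm_def f1_def f0_def thin_add thin_cmult)
  have T0: "T (y(k := False)) = thin \<rho> U f0 y" for y
    using insert(1,2)
    by (simp add: T_def thin_insert thin1_def thin_upd f0_def algebra_simps)
  have cd1: "cdiff i T (y(k := True)) = cdiff i (thin \<rho> U fm) y" if "i \<in> U" for i y
  proof -
    have ki: "k \<noteq> i" using that insert(2) by auto
    then show ?thesis by (simp only: cdiff_def fun_upd_twist[OF ki, of y True True] fun_upd_twist[OF ki, of y True False] T1)
  qed
  have cd0: "cdiff i T (y(k := False)) = cdiff i (thin \<rho> U f0) y" if "i \<in> U" for i y
  proof -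
    have ki: "k \<noteq> i" using that insert(2) by auto
    then show ?thesis by (simp only: cdiff_def fun_upd_twist[OF ki, of y False True] fun_upd_twist[OF ki, of y False False] T0)
  qed
  have cdk: "cdiff k T y = \<rho> * thin \<rho> U fd y" for y
  proof -
    have "cdiff k T y = thin \<rho> U fm y - thin \<rho> U f0 y"
      by (simp add: cdiff_def T1 T0)
    also have "\<dots> = \<rho> * thin \<rho> U fd y"
      by (simp add: fm_def fd_def thin_add thin_cmult thin_diff algebra_simps)
    finally show ?thesis .
  qed
  have cdk': "cdiff k T (y(k := b)) = \<rho> * thin \<rho> U fd y" for y b
    using cdk[of y] by (simp add: cdiff_def)
  define N where "N = (\<lambda>h. avg p U (\<lambda>x. (thin \<rho> U h x)\<^sup>2) x)"
  define I where "I = (\<lambda>h. \<Sum>i\<in>U. avg p U (\<lambda>x. (cdiff i (thin \<rho> U h) x)\<^sup>2) x)"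
  define B where "B = (\<lambda>h. avg (\<rho> * p) U h x)"
  have IH: "N h + p * (1 - \<rho>) * I h \<le> B (\<lambda>x. (h x)\<^sup>2)" for h
    using insert.IH[of h] by (simp add: N_def I_def B_def)
  have I0: "0 \<le> I h" for h
    unfolding I_def using p by (intro sum_nonneg avg_nonneg) auto
  have n: "avg p (insert k U) (\<lambda>x. (T x)\<^sup>2) x = p * N fm + (1 - p) * N f0"
    using insert(1,2) by (simp add: avg_insert_slices T1 T0 N_def)
  have "(\<Sum>i\<in>U. avg p (insert k U) (\<lambda>x. (cdiff i T x)\<^sup>2) x) = p * I fm + (1 - p) * I f0"
    using insert(1,2)
    by (simp add: avg_insert_slices cd1 cd0 I_def sum.distrib sum_distrib_left)
  moreover have "avg p (insert k U) (\<lambda>x. (cdiff k T x)\<^sup>2) x = \<rho>\<^sup>2 * N fd"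
    using insert(1,2)
    by (simp add: avg_insert_slices cdk' N_def power_mult_distrib avg_cmult algebra_simps)
  ultimately have s: "(\<Sum>i\<in>insert k U. avg p (insert k U) (\<lambda>x. (cdiff i T x)\<^sup>2) x)
      = \<rho>\<^sup>2 * N fd + (p * I fm + (1 - p) * I f0)"
    using insert(1,2) by simp
  have "B (\<lambda>x. (fm x)\<^sup>2) = B (\<lambda>x. (\<rho> * (f1 x)\<^sup>2 + (1 - \<rho>) * (f0 x)\<^sup>2) - \<rho> * (1 - \<rho>) * (fd x)\<^sup>2)"
    by (rule arg_cong[of _ _ B]) (simp add: fun_eq_iff fm_def fd_def power2_eq_square algebra_simps)
  then have b: "B (\<lambda>x. (fm x)\<^sup>2) = \<rho> * B (\<lambda>x. (f1 x)\<^sup>2) + (1 - \<rho>) * B (\<lambda>x. (f0 x)\<^sup>2)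
      - \<rho> * (1 - \<rho>) * B (\<lambda>x. (fd x)\<^sup>2)"
    by (simp add: B_def avg_diff avg_add avg_cmult)
  have r: "avg (\<rho> * p) (insert k U) (\<lambda>x. (f x)\<^sup>2) x
      = \<rho> * p * B (\<lambda>x. (f1 x)\<^sup>2) + (1 - \<rho> * p) * B (\<lambda>x. (f0 x)\<^sup>2)"
    using insert(1,2) by (simp add: avg_insert_slices f1_def f0_def B_def)
  \<comment> \<open>Dropping the influence term from the induction hypothesis leaves the contraction
    property of thinning.\<close>
  have d: "N fd \<le> B (\<lambda>x. (fd x)\<^sup>2)"
    using IH[of fd] I0[of fd] p \<rho> by (smt (verit) mult_nonneg_nonneg)
  have Bd: "0 \<le> B (\<lambda>x. (fd x)\<^sup>2)"
    unfolding B_def using p \<rho> by (intro avg_nonneg) (auto intro: mult_le_one)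
  have "p * (1 - \<rho>) * (\<rho>\<^sup>2 * N fd) \<le> p * (1 - \<rho>) * (\<rho> * B (\<lambda>x. (fd x)\<^sup>2))"
  proof (intro mult_left_mono)
    have "\<rho>\<^sup>2 * N fd \<le> \<rho>\<^sup>2 * B (\<lambda>x. (fd x)\<^sup>2)"
      using d by (intro mult_left_mono) auto
    also have "\<dots> \<le> \<rho> * B (\<lambda>x. (fd x)\<^sup>2)"
      using Bd \<rho> by (intro mult_right_mono) (auto simp: power2_eq_square mult_left_le)
    finally show "\<rho>\<^sup>2 * N fd \<le> \<rho> * B (\<lambda>x. (fd x)\<^sup>2)" .
  qed (use p \<rho> in auto)
  moreover have "p * (N fm + p * (1 - \<rho>) * I fm) \<le> p * B (\<lambda>x. (fm x)\<^sup>2)"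
    using IH p by (intro mult_left_mono) auto
  moreover have "(1 - p) * (N f0 + p * (1 - \<rho>) * I f0) \<le> (1 - p) * B (\<lambda>x. (f0 x)\<^sup>2)"
    using IH p by (intro mult_left_mono) auto
  ultimately show ?case
    unfolding T_def[symmetric] n s r b by (simp add: algebra_simps)
qed simp

lemma avg_square_deviation:
  assumes "finite S"
  shows "avg q S (\<lambda>y. (F y - avg q S F y)\<^sup>2) x = avg q S (\<lambda>y. (F y)\<^sup>2) x - (avg q S F x)\<^sup>2"
proof -
  have e: "(\<lambda>y. (F y - avg q S F y)\<^sup>2) =
      (\<lambda>y. (F y)\<^sup>2 - 2 * (avg q S F y * F y) + avg q S F y * avg q S F y)"
    by (simp add: fun_eq_iff power2_eq_square algebra_simps)
  have "avg q S (\<lambda>y. avg q S F y * G y) x = avg q S F x * avg q S G x" for G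
    using assms by (intro avg_mult_left avg_upd_inside)
  moreover have "avg q S (avg q S F) x = avg q S F x"
    using assms by (intro avg_invariant avg_upd_inside)
  ultimately show ?thesis
    unfolding e avg_add avg_diff avg_cmult by (simp add: power2_eq_square)
qed

lemma square_avg_le:
  assumes "0 \<le> q" "q \<le> 1"
  shows "(avg q S F x)\<^sup>2 \<le> avg q S (\<lambda>y. (F y)\<^sup>2) x"
proof (cases "finite S")
  case True
  then show ?thesis
    using avg_nonneg[OF assms, of "\<lambda>y. (F y - avg q S F y)\<^sup>2" S x] avg_square_deviation[OF True, of q F x]
    by simp
qed (simp add: avg_infinite)

text \<open>Efron-Stein inequality by the law of total variance: conditioning on bit
  \<open>k\<close> gives the mean of the two conditional variances plus \<open>q * (1 - q)\<close>
  times the squared difference of the means, which Jensen bounds by the influence of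
  \<open>k\<close>.\<close>

lemma avg_variance_le:
  assumes "finite S" and q: "0 \<le> q" "q \<le> 1"
  shows "avg q S (\<lambda>y. (F y)\<^sup>2) x - (avg q S F x)\<^sup>2 \<le> (\<Sum>i\<in>S. avg q S (\<lambda>y. (cdiff i F y)\<^sup>2) x)"
  using assms(1)
proof (induction S arbitrary: F rule: finite_induct)
  case (insert k S)
  define F1 where "F1 = (\<lambda>y. F (y(k := True)))"
  define F0 where "F0 = (\<lambda>y. F (y(k := False)))"
  define A where "A = (\<lambda>h. avg q S h x)"
  define V where "V = (\<lambda>h. A (\<lambda>y. (h y)\<^sup>2) - (A h)\<^sup>2)"
  define I where "I = (\<lambda>h. \<Sum>i\<in>S. A (\<lambda>y. (cdiff i h y)\<^sup>2))"
  have IH: "V h \<le> I h" for h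
    using insert.IH[of h] by (simp add: V_def I_def A_def)
  have cd: "cdiff i F (y(k := True)) = cdiff i F1 y" "cdiff i F (y(k := False)) = cdiff i F0 y"
    if "i \<in> S" for i y
  proof -
    have ki: "k \<noteq> i" using that insert(2) by auto
    then show "cdiff i F (y(k := True)) = cdiff i F1 y" "cdiff i F (y(k := False)) = cdiff i F0 y"
      by (simp_all only: cdiff_def fun_upd_twist[OF ki, of y True True] fun_upd_twist[OF ki, of y True False] fun_upd_twist[OF ki, of y False True] fun_upd_twist[OF ki, of y False False] F1_def F0_def)
  qed
  have "(\<Sum>i\<in>S. avg q (insert k S) (\<lambda>y. (cdiff i F y)\<^sup>2) x) = q * I F1 + (1 - q) * I F0"
    using insert(1,2)
    by (simp add: avg_insert_slices cd I_def A_def sum.distrib sum_distrib_left)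
  moreover have "avg q (insert k S) (\<lambda>y. (cdiff k F y)\<^sup>2) x = A (\<lambda>y. (F1 y - F0 y)\<^sup>2)"
    using insert(1,2)
    by (simp add: avg_insert_slices cdiff_def F1_def F0_def A_def algebra_simps)
  ultimately have s: "(\<Sum>i\<in>insert k S. avg q (insert k S) (\<lambda>y. (cdiff i F y)\<^sup>2) x)
      = A (\<lambda>y. (F1 y - F0 y)\<^sup>2) + (q * I F1 + (1 - q) * I F0)"
    using insert(1,2) by simp
  have "(A F1 - A F0)\<^sup>2 \<le> A (\<lambda>y. (F1 y - F0 y)\<^sup>2)"
    using square_avg_le[OF q, of S "\<lambda>y. F1 y - F0 y" x] by (simp add: A_def avg_diff)
  moreover have "q * (1 - q) * (A F1 - A F0)\<^sup>2 \<le> 1 * (A F1 - A F0)\<^sup>2"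
    using q by (intro mult_right_mono) (auto intro: mult_le_one)
  moreover have "q * V F1 \<le> q * I F1" "(1 - q) * V F0 \<le> (1 - q) * I F0"
    using IH q by (auto intro: mult_left_mono)
  moreover have "avg q (insert k S) (\<lambda>y. (F y)\<^sup>2) x - (avg q (insert k S) F x)\<^sup>2
      = q * V F1 + (1 - q) * V F0 + q * (1 - q) * (A F1 - A F0)\<^sup>2"
    using insert(1,2)
    by (simp add: avg_insert_slices V_def A_def F1_def F0_def power2_eq_square algebra_simps)
  ultimately show ?case
    unfolding s by linarith
qed simp

lemma efron_stein:
  assumes "finite U" "B \<subseteq> U" and q: "0 \<le> q" "q \<le> 1"
  shows "avg q U (\<lambda>y. (F y - avg q B F y)\<^sup>2) x \<le> (\<Sum>i\<in>B. avg q U (\<lambda>y. (cdiff i F y)\<^sup>2) x)"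
proof -
  have B: "finite B" using assms finite_subset by auto
  have "avg q U (\<lambda>y. (F y - avg q B F y)\<^sup>2) x = avg q U (avg q B (\<lambda>y. (F y - avg q B F y)\<^sup>2)) x"
    using avg_avg_subset assms by metis
  also have "\<dots> \<le> avg q U (\<lambda>z. \<Sum>i\<in>B. avg q B (\<lambda>y. (cdiff i F y)\<^sup>2) z) x"
    using avg_variance_le[OF B q] by (intro avg_mono q) (simp add: avg_square_deviation B)
  also have "\<dots> = (\<Sum>i\<in>B. avg q U (avg q B (\<lambda>y. (cdiff i F y)\<^sup>2)) x)"
    by (simp add: avg_sum)
  also have "\<dots> = (\<Sum>i\<in>B. avg q U (\<lambda>y. (cdiff i F y)\<^sup>2) x)"
    using avg_avg_subset[OF assms(1,2)] by simp
  finally show ?thesis .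
qed

section \<open>Small-set expansion\<close>

text \<open>Tangent line at \<open>1\<close> of a concave power, read off from Young's inequality
  with second argument \<open>1\<close>.\<close>

lemma powr_le_affine:
  fixes t :: real
  assumes "0 \<le> t" "0 \<le> \<delta>" "\<delta> \<le> 1"
  shows "t powr \<delta> \<le> 1 + \<delta> * (t - 1)"
proof (cases "t = 0")
  case False
  then show ?thesis
    using Youngs_inequality_0[of \<delta> "1 - \<delta>" t 1] assms by (simp add: algebra_simps)
qed (use assms in simp)

text \<open>Bernoulli's inequality, by applying the concave bound with exponent
  \<open>1 / (1 + \<delta>)\<close> to \<open>x powr (1 + \<delta>)\<close>.\<close>

lemma powr_ge_affine:
  fixes x :: real
  assumes "0 \<le> x" "0 \<le> \<delta>"
  shows "1 + (1 + \<delta>) * (x - 1) \<le> x powr (1 + \<delta>)"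
proof -
  have "x = (x powr (1 + \<delta>)) powr (1 / (1 + \<delta>))"
    using assms by (simp add: powr_powr)
  also have "\<dots> \<le> 1 + (1 / (1 + \<delta>)) * (x powr (1 + \<delta>) - 1)"
    using assms by (intro powr_le_affine) auto
  finally have "(1 + \<delta>) * x \<le> (1 + \<delta>) * (1 + (1 / (1 + \<delta>)) * (x powr (1 + \<delta>) - 1))"
    using assms by (intro mult_left_mono) auto
  also have "\<dots> = \<delta> + x powr (1 + \<delta>)"
    using assms by (simp add: distrib_left)
  finally show ?thesis
    by (simp add: algebra_simps)
qed

text \<open>Tangent lines at \<open>1\<close> bound \<open>t powr \<delta>\<close> from above and
  the power of the mean from below, which leaves exactly
  \<open>w * (\<delta> * (1 - t)\<^sup>2)\<close>. The factor \<open>4\<close> comes from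
  \<open>1 - t \<le> 2 * (1 - sqrt t)\<close>.\<close>

lemma powr_jensen_gap_unit:
  fixes t w \<delta> :: real
  assumes t: "0 \<le> t" "t \<le> 1" and w: "0 \<le> w" "w \<le> 1" and \<delta>: "0 \<le> \<delta>" "\<delta> \<le> 1"
  shows "(1 - w) + w * t powr (1 + \<delta>) - ((1 - w) + w * t) powr (1 + \<delta>)
    \<le> 4 * \<delta> * (1 - t powr ((1 + \<delta>) / 2))\<^sup>2"
proof -
  have "t powr (1 + \<delta>) = t * t powr \<delta>"
    using t by (simp add: powr_add)
  also have "\<dots> \<le> t * (1 + \<delta> * (t - 1))"
    using t \<delta> by (intro mult_left_mono powr_le_affine) auto
  finally have 1: "w * t powr (1 + \<delta>) \<le> w * (t * (1 + \<delta> * (t - 1)))"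
    using w by (intro mult_left_mono)
  have 2: "1 + (1 + \<delta>) * (((1 - w) + w * t) - 1) \<le> ((1 - w) + w * t) powr (1 + \<delta>)"
    using t w \<delta> by (intro powr_ge_affine) auto
  have "t powr ((1 + \<delta>) / 2) \<le> t powr (1 / 2)"
    using t \<delta> by (intro powr_mono') auto
  then have 3: "t powr ((1 + \<delta>) / 2) \<le> sqrt t"
    using t by (simp add: powr_half_sqrt)
  have "1 - t = (1 - sqrt t) * (1 + sqrt t)"
    using t by (simp add: algebra_simps)
  also have "\<dots> \<le> (1 - sqrt t) * 2"
    using t by (intro mult_left_mono) auto
  also have "\<dots> \<le> (1 - t powr ((1 + \<delta>) / 2)) * 2"
    using 3 by (intro mult_right_mono) auto
  finally have "1 - t \<le> 2 * (1 - t powr ((1 + \<delta>) / 2))"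
    by (simp only: mult.commute)
  then have "(1 - t)\<^sup>2 \<le> (2 * (1 - t powr ((1 + \<delta>) / 2)))\<^sup>2"
    using t by (intro power_mono) auto
  then have 4: "\<delta> * (1 - t)\<^sup>2 \<le> \<delta> * (4 * (1 - t powr ((1 + \<delta>) / 2))\<^sup>2)"
    unfolding power_mult_distrib using \<delta> by (intro mult_left_mono) auto
  have "w * (\<delta> * (1 - t)\<^sup>2) \<le> \<delta> * (1 - t)\<^sup>2"
    using w \<delta> by (intro mult_left_le_one_le) auto
  moreover have "(1 - w) + w * (t * (1 + \<delta> * (t - 1))) - (1 + (1 + \<delta>) * (((1 - w) + w * t) - 1))
      = w * (\<delta> * (1 - t)\<^sup>2)"
    by (simp add: power2_eq_square algebra_simps)
  ultimately show ?thesis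
    using 1 2 4 by linarith
qed

text \<open>Both sides are homogeneous of degree \<open>1 + \<delta>\<close>, so dividing by the
  larger endpoint \<open>a\<close> reduces to the unit case.\<close>

lemma powr_jensen_gap_ordered:
  fixes a b w \<delta> :: real
  assumes ab: "0 \<le> b" "b \<le> a" and w: "0 \<le> w" "w \<le> 1" and \<delta>: "0 \<le> \<delta>" "\<delta> \<le> 1"
  shows "(1 - w) * a powr (1 + \<delta>) + w * b powr (1 + \<delta>) - ((1 - w) * a + w * b) powr (1 + \<delta>)
    \<le> 4 * \<delta> * (a powr ((1 + \<delta>) / 2) - b powr ((1 + \<delta>) / 2))\<^sup>2"
proof (cases "a = 0")
  case True
  then show ?thesis using ab by simp
next
  case False
  define t where "t = b / a"
  have t: "0 \<le> t" "t \<le> 1" "b = a * t" and a: "0 < a"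
    using False ab by (auto simp: t_def)
  have w': "0 \<le> (1 - w) + w * t" using t w by auto
  have e: "a powr (1 + \<delta>) = (a powr ((1 + \<delta>) / 2))\<^sup>2"
    using a by (simp add: power2_eq_square flip: powr_add)
  have "((1 - w) * a + w * b) = a * ((1 - w) + w * t)"
    by (simp add: t(3) algebra_simps)
  then have "((1 - w) * a + w * b) powr (1 + \<delta>) = a powr (1 + \<delta>) * ((1 - w) + w * t) powr (1 + \<delta>)"
    using a w' by (simp only: powr_mult)
  then have "(1 - w) * a powr (1 + \<delta>) + w * b powr (1 + \<delta>) - ((1 - w) * a + w * b) powr (1 + \<delta>)
    = a powr (1 + \<delta>) * ((1 - w) + w * t powr (1 + \<delta>) - ((1 - w) + w * t) powr (1 + \<delta>))"
    using a t by (simp add: powr_mult algebra_simps)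
  also have "\<dots> \<le> a powr (1 + \<delta>) * (4 * \<delta> * (1 - t powr ((1 + \<delta>) / 2))\<^sup>2)"
    using t w \<delta> by (intro mult_left_mono powr_jensen_gap_unit) auto
  also have "\<dots> = 4 * \<delta> * (a powr ((1 + \<delta>) / 2) - b powr ((1 + \<delta>) / 2))\<^sup>2"
    using a t unfolding e by (simp add: powr_mult power2_eq_square algebra_simps)
  finally show ?thesis .
qed

lemma powr_jensen_gap:
  fixes a b w \<delta> :: real
  assumes ab: "0 \<le> a" "0 \<le> b" and w: "0 \<le> w" "w \<le> 1" and \<delta>: "0 \<le> \<delta>" "\<delta> \<le> 1"
  shows "(1 - w) * a powr (1 + \<delta>) + w * b powr (1 + \<delta>) - ((1 - w) * a + w * b) powr (1 + \<delta>)
    \<le> 4 * \<delta> * (a powr ((1 + \<delta>) / 2) - b powr ((1 + \<delta>) / 2))\<^sup>2"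
proof (cases "b \<le> a")
  case True
  then show ?thesis using powr_jensen_gap_ordered assms by blast
next
  case False
  then show ?thesis
    using powr_jensen_gap_ordered[of a b "1 - w" \<delta>] assms
    by (simp add: power2_commute[of "b powr _"] add.commute)
qed

text \<open>The one-coordinate case of small-set expansion: \<open>a\<close>, \<open>b\<close> stand
  for the measures of the two slices of a set and \<open>c\<close>, \<open>d\<close> for the norms
  of the two slices of a function. At exponent \<open>1 / 2\<close> the estimate has some slack, and
  \<open>gap\<close> says that this slack covers the Jensen gap caused by the larger
  exponent.\<close>

lemma two_point_small_set:
  fixes a b c d p \<rho> \<delta> :: real
  assumes pos: "0 \<le> a" "0 \<le> b" "0 \<le> c" "0 \<le> d" and p: "0 \<le> p" "p \<le> 1" and \<rho>: "0 \<le> \<rho>" "\<rho> \<le> 1"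
    and \<delta>: "0 \<le> \<delta>" "\<delta> \<le> 1" and \<rho>p: "\<rho> * p < 1" and gap: "4 * \<delta> * (1 - \<rho> * p) \<le> p * (1 - p) * (1 - \<rho>)"
  shows "p * (b powr ((1 + \<delta>) / 2) * (\<rho> * d + (1 - \<rho>) * c)) + (1 - p) * (a powr ((1 + \<delta>) / 2) * c)
    \<le> (p * b + (1 - p) * a) powr ((1 + \<delta>) / 2) * sqrt (\<rho> * p * d\<^sup>2 + (1 - \<rho> * p) * c\<^sup>2)"
proof -
  define A where "A = a powr ((1 + \<delta>) / 2)"
  define B where "B = b powr ((1 + \<delta>) / 2)"
  define M where "M = (p * b + (1 - p) * a) powr ((1 + \<delta>) / 2)"
  \<comment> \<open>\<open>L\<close> is the coefficient of \<open>c\<close>. Its weights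
    \<open>1 - p\<close> and \<open>p * (1 - \<rho>)\<close> add up to \<open>1 - r\<close>, so the
    variance identity behind \<open>LM\<close> yields exactly
    \<open>p * (1 - p) * (1 - \<rho>) * (A - B)\<^sup>2\<close>.\<close>
  define L where "L = (1 - p) * A + p * (1 - \<rho>) * B"
  define r where "r = \<rho> * p"
  have r: "0 \<le> r" "r < 1" using p \<rho> \<rho>p by (auto simp: r_def)
  have sq: "x powr (1 + \<delta>) = (x powr ((1 + \<delta>) / 2))\<^sup>2" for x :: real
    by (simp add: power2_eq_square flip: powr_add)
  have "(1 - p) * A\<^sup>2 + p * B\<^sup>2 - M\<^sup>2 \<le> 4 * \<delta> * (A - B)\<^sup>2"
    using powr_jensen_gap[of a b p \<delta>] pos p \<delta> unfolding sq A_def B_def M_def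
    by (simp add: add.commute)
  then have "(1 - r) * ((1 - p) * A\<^sup>2 + p * B\<^sup>2 - M\<^sup>2) \<le> (1 - r) * (4 * \<delta> * (A - B)\<^sup>2)"
    using r by (intro mult_left_mono) auto
  also have "\<dots> = 4 * \<delta> * (1 - r) * (A - B)\<^sup>2" by simp
  also have "\<dots> \<le> p * (1 - p) * (1 - \<rho>) * (A - B)\<^sup>2"
    using gap by (intro mult_right_mono) (auto simp: r_def)
  finally have LM: "L\<^sup>2 + (1 - r) * (r * B\<^sup>2) \<le> (1 - r) * M\<^sup>2"
    unfolding L_def r_def by (simp add: power2_eq_square algebra_simps)
  have LM': "L\<^sup>2 / (1 - r) + r * B\<^sup>2 \<le> M\<^sup>2"
  proof -
    have "(1 - r) * (L\<^sup>2 / (1 - r) + r * B\<^sup>2) \<le> (1 - r) * M\<^sup>2"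
      using LM r by (simp add: distrib_left)
    then show ?thesis using r by simp
  qed
  \<comment> \<open>Weighted Cauchy-Schwarz with its exact remainder (Lagrange's identity).\<close>
  have "(c * L + r * B * d)\<^sup>2 + r * (L * d - (1 - r) * B * c)\<^sup>2 / (1 - r)
      = (L\<^sup>2 / (1 - r) + r * B\<^sup>2) * (r * d\<^sup>2 + (1 - r) * c\<^sup>2)"
    using r by (simp add: field_simps power2_eq_square)
  then have "(c * L + r * B * d)\<^sup>2 \<le> (L\<^sup>2 / (1 - r) + r * B\<^sup>2) * (r * d\<^sup>2 + (1 - r) * c\<^sup>2)"
    using r by (smt (verit) divide_nonneg_nonneg mult_nonneg_nonneg zero_le_power2)
  also have "\<dots> \<le> M\<^sup>2 * (r * d\<^sup>2 + (1 - r) * c\<^sup>2)"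
    using LM' r by (intro mult_right_mono) auto
  also have "\<dots> = (M * sqrt (r * d\<^sup>2 + (1 - r) * c\<^sup>2))\<^sup>2"
    using r by (simp add: power_mult_distrib)
  finally have "c * L + r * B * d \<le> M * sqrt (r * d\<^sup>2 + (1 - r) * c\<^sup>2)"
    by (rule power2_le_imp_le) (use r in \<open>auto simp: M_def\<close>)
  moreover have "c * L + r * B * d = p * (B * (\<rho> * d + (1 - \<rho>) * c)) + (1 - p) * (A * c)"
    by (simp add: L_def r_def algebra_simps)
  ultimately show ?thesis
    by (simp add: A_def B_def M_def r_def)
qed

text \<open>Tensorization: the measures and norms of the slices at the new coordinate are the four
  numbers of the two-point inequality, and the induction hypothesis is applied to three pairs of
  slices.\<close>

lemma thin_small_set:
  fixes p \<rho> \<delta> :: real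
  assumes "finite U" and h: "\<And>x. 0 \<le> h x" and p: "0 \<le> p" "p \<le> 1" and \<rho>: "0 \<le> \<rho>" "\<rho> \<le> 1"
    and \<delta>: "0 \<le> \<delta>" "\<delta> \<le> 1" and \<rho>p: "\<rho> * p < 1" and gap: "4 * \<delta> * (1 - \<rho> * p) \<le> p * (1 - p) * (1 - \<rho>)"
  shows "avg p U (\<lambda>x. of_bool (P x) * thin \<rho> U h x) x
    \<le> (avg p U (\<lambda>x. of_bool (P x)) x) powr ((1 + \<delta>) / 2) * sqrt (avg (\<rho> * p) U (\<lambda>x. (h x)\<^sup>2) x)"
  using assms(1) h
proof (induction U arbitrary: P h rule: finite_induct)
  case empty
  then show ?case by (cases "P x") simp_all
next
  case (insert k U)
  define P1 where "P1 = (\<lambda>y. P (y(k := True)))"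
  define P0 where "P0 = (\<lambda>y. P (y(k := False)))"
  define h1 where "h1 = (\<lambda>y. h (y(k := True)))"
  define h0 where "h0 = (\<lambda>y. h (y(k := False)))"
  define \<mu> where "\<mu> = (\<lambda>Q. avg p U (\<lambda>x. of_bool (Q x)) x)"
  define N where "N = (\<lambda>g. sqrt (avg (\<rho> * p) U (\<lambda>x. (g x)\<^sup>2) x))"
  define C where "C = (\<lambda>Q g. avg p U (\<lambda>x. of_bool (Q x) * thin \<rho> U g x) x)"
  have IH: "C Q g \<le> \<mu> Q powr ((1 + \<delta>) / 2) * N g" if "\<And>x. 0 \<le> g x" for Q g
    using insert.IH[OF that, of Q] by (simp add: C_def \<mu>_def N_def)
  have h01: "0 \<le> h0 x" "0 \<le> h1 x" for x
    using insert.prems by (auto simp: h0_def h1_def)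
  have rp: "0 \<le> \<rho> * p" "\<rho> * p \<le> 1" using p \<rho> \<rho>p by auto
  have \<mu>0: "0 \<le> \<mu> Q" for Q unfolding \<mu>_def by (intro avg_nonneg p) auto
  have N0: "0 \<le> N g" for g unfolding N_def by (intro real_sqrt_ge_zero avg_nonneg rp) auto
  have N2: "(N g)\<^sup>2 = avg (\<rho> * p) U (\<lambda>x. (g x)\<^sup>2) x" for g
    unfolding N_def by (intro real_sqrt_pow2 avg_nonneg rp) auto
  have T1: "thin \<rho> (insert k U) h (y(k := True)) = \<rho> * thin \<rho> U h1 y + (1 - \<rho>) * thin \<rho> U h0 y" for y
    using insert(1,2) by (simp add: thin_insert thin1_def thin_upd h1_def h0_def)
  have T0: "thin \<rho> (insert k U) h (y(k := False)) = thin \<rho> U h0 y" for y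
    using insert(1,2) by (simp add: thin_insert thin1_def thin_upd h0_def algebra_simps)
  have "avg p (insert k U) (\<lambda>x. of_bool (P x) * thin \<rho> (insert k U) h x) x
     = p * avg p U (\<lambda>y. \<rho> * (of_bool (P1 y) * thin \<rho> U h1 y) + (1 - \<rho>) * (of_bool (P1 y) * thin \<rho> U h0 y)) x
       + (1 - p) * C P0 h0"
    using insert(1,2) by (simp add: avg_insert_slices T1 T0 C_def P1_def P0_def algebra_simps)
  also have "\<dots> = p * (\<rho> * C P1 h1 + (1 - \<rho>) * C P1 h0) + (1 - p) * C P0 h0"
    unfolding avg_add avg_cmult C_def ..
  also have "\<dots> \<le> p * (\<rho> * (\<mu> P1 powr ((1 + \<delta>) / 2) * N h1) + (1 - \<rho>) * (\<mu> P1 powr ((1 + \<delta>) / 2) * N h0))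
       + (1 - p) * (\<mu> P0 powr ((1 + \<delta>) / 2) * N h0)"
    using p \<rho> h01 by (intro add_mono mult_left_mono IH) auto
  also have "\<dots> = p * (\<mu> P1 powr ((1 + \<delta>) / 2) * (\<rho> * N h1 + (1 - \<rho>) * N h0))
       + (1 - p) * (\<mu> P0 powr ((1 + \<delta>) / 2) * N h0)"
    by (simp add: algebra_simps)
  also have "\<dots> \<le> (p * \<mu> P1 + (1 - p) * \<mu> P0) powr ((1 + \<delta>) / 2) * sqrt (\<rho> * p * (N h1)\<^sup>2 + (1 - \<rho> * p) * (N h0)\<^sup>2)"
    by (intro two_point_small_set \<mu>0 N0 p \<rho> \<delta> \<rho>p gap)
  also have "\<dots> = (avg p (insert k U) (\<lambda>x. of_bool (P x)) x) powr ((1 + \<delta>) / 2)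
       * sqrt (avg (\<rho> * p) (insert k U) (\<lambda>x. (h x)\<^sup>2) x)"
    using insert(1,2) by (simp add: avg_insert_slices N2 \<mu>_def P1_def P0_def h1_def h0_def)
  finally show ?case .
qed

section \<open>Resampling blocks of coordinates\<close>

text \<open>Pythagoras: averaging over \<open>B\<close> is an orthogonal projection.\<close>

lemma avg_square_deviation_subset:
  assumes "finite U" "B \<subseteq> U"
  shows "avg q U (\<lambda>y. (F y - avg q B F y)\<^sup>2) x
    = avg q U (\<lambda>y. (F y)\<^sup>2) x - avg q U (\<lambda>y. (avg q B F y)\<^sup>2) x"
proof -
  have B: "finite B" using finite_subset assms by blast
  have "avg q U (\<lambda>y. (F y - avg q B F y)\<^sup>2) x = avg q U (avg q B (\<lambda>y. (F y - avg q B F y)\<^sup>2)) x"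
    using avg_avg_subset assms by metis
  also have "\<dots> = avg q U (\<lambda>y. avg q B (\<lambda>y. (F y)\<^sup>2) y - (avg q B F y)\<^sup>2) x"
    by (rule arg_cong[of _ _ "\<lambda>G. avg q U G x"]) (simp add: fun_eq_iff avg_square_deviation B)
  also have "\<dots> = avg q U (\<lambda>y. (F y)\<^sup>2) x - avg q U (\<lambda>y. (avg q B F y)\<^sup>2) x"
    using avg_avg_subset[OF assms] by (simp add: avg_diff)
  finally show ?thesis .
qed

text \<open>Averages over disjoint blocks commute and contract the squared norm, so averaging over
  \<open>A\<close> removes no more from \<open>avg q B F\<close> than from \<open>F\<close>.\<close>

lemma avg_square_deviation_union_le:
  assumes U: "finite U" "A \<union> B \<subseteq> U" "A \<inter> B = {}" and q: "0 \<le> q" "q \<le> 1"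
  shows "avg q U (\<lambda>y. (F y - avg q (A \<union> B) F y)\<^sup>2) x
    \<le> avg q U (\<lambda>y. (F y - avg q A F y)\<^sup>2) x + avg q U (\<lambda>y. (F y - avg q B F y)\<^sup>2) x"
proof -
  have sub: "A \<subseteq> U" "B \<subseteq> U" and fin: "finite A" "finite B" using U finite_subset by auto
  have AB: "avg q (A \<union> B) F = avg q A (avg q B F)"
    using avg_union[OF fin U(3)] .
  have BA: "avg q A (avg q B F) = avg q B (avg q A F)"
    using avg_union[OF fin(2,1), of q F] AB U(3) by (simp add: Un_commute Int_commute)
  have dev: "avg q B F y - avg q A (avg q B F) y = avg q B (\<lambda>y. F y - avg q A F y) y" for y
    unfolding BA avg_diff ..
  have "avg q U (\<lambda>y. (avg q B F y)\<^sup>2) x - avg q U (\<lambda>y. (avg q A (avg q B F) y)\<^sup>2) x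
     = avg q U (\<lambda>y. (avg q B (\<lambda>y. F y - avg q A F y) y)\<^sup>2) x"
    unfolding avg_square_deviation_subset[OF U(1) sub(1), symmetric] dev ..
  also have "\<dots> \<le> avg q U (avg q B (\<lambda>y. (F y - avg q A F y)\<^sup>2)) x"
    by (intro avg_mono q square_avg_le)
  also have "\<dots> = avg q U (\<lambda>y. (F y - avg q A F y)\<^sup>2) x"
    using avg_avg_subset[OF U(1) sub(2)] .
  finally show ?thesis
    using avg_square_deviation_subset[OF U(1,2), of q F x]
      avg_square_deviation_subset[OF U(1) sub(2), of q F x]
    unfolding AB by linarith
qed

text \<open>Expanding the square along \<open>B\<close>, the second error exceeds the first by
  \<open>(avg q B F y - \<phi> y)\<^sup>2\<close>.\<close>

lemma avg_square_deviation_least: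
  assumes U: "finite U" "B \<subseteq> U" and q: "0 \<le> q" "q \<le> 1"
    and \<phi>: "\<And>i x b. i \<in> B \<Longrightarrow> \<phi> (x(i := b)) = \<phi> x"
  shows "avg q U (\<lambda>y. (F y - avg q B F y)\<^sup>2) x \<le> avg q U (\<lambda>y. (F y - \<phi> y)\<^sup>2) x"
proof -
  have B: "finite B" using finite_subset U by blast
  have "avg q B (\<lambda>y. (F y - avg q B F y)\<^sup>2) y \<le> avg q B (\<lambda>y. (F y - \<phi> y)\<^sup>2) y" for y
  proof -
    have e: "(\<lambda>y. (F y - \<phi> y)\<^sup>2) = (\<lambda>y. (F y)\<^sup>2 - 2 * (\<phi> y * F y) + \<phi> y * \<phi> y)"
      by (simp add: fun_eq_iff power2_eq_square algebra_simps)
    have "avg q B (\<lambda>y. (F y - \<phi> y)\<^sup>2) y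
        = avg q B (\<lambda>y. (F y)\<^sup>2) y - 2 * (\<phi> y * avg q B F y) + \<phi> y * \<phi> y"
      unfolding e avg_add avg_diff avg_cmult
      using avg_mult_left[OF \<phi>, of B q] avg_invariant[OF \<phi>, of B q] by simp
    moreover have "(avg q B F y - \<phi> y)\<^sup>2 = (avg q B F y)\<^sup>2 - 2 * (\<phi> y * avg q B F y) + \<phi> y * \<phi> y"
      by algebra
    moreover note avg_square_deviation[OF B, of q F y] zero_le_power2[of "avg q B F y - \<phi> y"]
    ultimately show ?thesis by linarith
  qed
  then have "avg q U (avg q B (\<lambda>y. (F y - avg q B F y)\<^sup>2)) x \<le> avg q U (avg q B (\<lambda>y. (F y - \<phi> y)\<^sup>2)) x"
    by (rule avg_mono[OF q])
  then show ?thesis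
    unfolding avg_avg_subset[OF U] .
qed

text \<open>Compare \<open>g\<close> with the block average of \<open>u\<close> rounded at
  \<open>2 * c\<close>, which ignores \<open>B\<close>. This level is at least \<open>c\<close> away
  from both sides of the gap between \<open>c\<close> and \<open>4 * c\<close>, so off
  \<open>P\<close> a wrong rounding forces \<open>u\<close> to deviate by at least
  \<open>c\<close>.\<close>

lemma threshold_square_deviation_le:
  fixes g P :: "('a \<Rightarrow> bool) \<Rightarrow> bool"
  assumes U: "finite U" "B \<subseteq> U" and q: "0 \<le> q" "q \<le> 1"
    and g: "\<And>x. \<not> P x \<Longrightarrow> g x \<Longrightarrow> 4 * c < u x" "\<And>x. \<not> P x \<Longrightarrow> \<not> g x \<Longrightarrow> u x < c" and c: "0 < c"
  shows "avg q U (\<lambda>y. (of_bool (g y) - avg q B (\<lambda>y. of_bool (g y)) y)\<^sup>2) x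
    \<le> avg q U (\<lambda>y. of_bool (P y)) x + avg q U (\<lambda>y. of_bool (c \<le> \<bar>u y - avg q B u y\<bar>)) x"
proof -
  define \<phi> :: "('a \<Rightarrow> bool) \<Rightarrow> real" where "\<phi> = (\<lambda>x. of_bool (2 * c \<le> avg q B u x))"
  have B: "finite B" using finite_subset U by blast
  have "avg q U (\<lambda>y. (of_bool (g y) - avg q B (\<lambda>y. of_bool (g y)) y)\<^sup>2) x
     \<le> avg q U (\<lambda>y. (of_bool (g y) - \<phi> y)\<^sup>2) x"
    using avg_upd_inside[OF B] by (intro avg_square_deviation_least U q) (simp add: \<phi>_def)
  also have "\<dots> \<le> avg q U (\<lambda>y. of_bool (P y) + of_bool (c \<le> \<bar>u y - avg q B u y\<bar>)) x"
  proof (intro avg_mono q)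
    fix y
    show "(of_bool (g y) - \<phi> y)\<^sup>2 \<le> of_bool (P y) + of_bool (c \<le> \<bar>u y - avg q B u y\<bar>)"
      using g[of y] c by (auto simp: \<phi>_def of_bool_def split: if_splits)
  qed
  finally show ?thesis by (simp add: avg_add)
qed

text \<open>Markov's inequality in which the smallness of the bad event is fed back through
  small-set expansion, while Efron-Stein bounds the norm of the deviation. Compared with Chebyshev's
  \<open>W / c\<^sup>2\<close> the bound carries the extra factor
  \<open>(w / c\<^sup>2) powr \<delta>\<close>.\<close>

lemma prob_large_deviation_le:
  fixes p \<rho> \<delta> :: real
  assumes U: "finite U" "B \<subseteq> U" and p: "0 \<le> p" "p \<le> 1" and \<rho>: "0 \<le> \<rho>" "\<rho> \<le> 1"
    and \<delta>: "0 \<le> \<delta>" "\<delta> \<le> 1" and \<rho>p: "\<rho> * p < 1" and gap: "4 * \<delta> * (1 - \<rho> * p) \<le> p * (1 - p) * (1 - \<rho>)"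
    and c: "0 < c" and u: "u = thin \<rho> U v"
    and W: "W = (\<Sum>i\<in>B. avg (\<rho> * p) U (\<lambda>y. (cdiff i v y)\<^sup>2) x)" "W \<le> w"
  shows "avg p U (\<lambda>y. of_bool (c \<le> \<bar>u y - avg p B u y\<bar>)) x \<le> (w / c\<^sup>2) powr \<delta> / c\<^sup>2 * W"
proof -
  define \<mu> where "\<mu> = avg p U (\<lambda>y. of_bool (c \<le> \<bar>u y - avg p B u y\<bar>)) x"
  define D where "D = (\<lambda>y. v y - avg (\<rho> * p) B v y)"
  have rp: "0 \<le> \<rho> * p" "\<rho> * p \<le> 1" using p \<rho> \<rho>p by auto
  have \<mu>: "0 \<le> \<mu>" unfolding \<mu>_def by (intro avg_nonneg p) auto
  have "\<mu> \<le> avg p U (\<lambda>_. 1) x" unfolding \<mu>_def by (intro avg_mono p) auto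
  then have \<mu>1: "\<mu> \<le> 1" by (simp add: avg_const)
  have W0: "0 \<le> W" unfolding W(1) by (intro sum_nonneg avg_nonneg rp) auto
  have dev: "u y - avg p B u y = thin \<rho> U D y" for y
    unfolding u avg_thin[OF U] D_def thin_diff ..
  have "c * \<mu> = avg p U (\<lambda>y. c * of_bool (c \<le> \<bar>u y - avg p B u y\<bar>)) x"
    by (simp add: \<mu>_def avg_cmult)
  also have "\<dots> \<le> avg p U (\<lambda>y. of_bool (c \<le> \<bar>u y - avg p B u y\<bar>) * thin \<rho> U (\<lambda>y. \<bar>D y\<bar>) y) x"
    using abs_thin_le[OF \<rho>, of U D] unfolding dev
    by (intro avg_mono p) (auto simp: of_bool_def intro: order_trans)
  also have "\<dots> \<le> \<mu> powr ((1 + \<delta>) / 2) * sqrt (avg (\<rho> * p) U (\<lambda>y. \<bar>D y\<bar>\<^sup>2) x)"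
    unfolding \<mu>_def by (intro thin_small_set U p \<rho> \<delta> \<rho>p gap) auto
  also have "\<dots> \<le> \<mu> powr ((1 + \<delta>) / 2) * sqrt W"
    using efron_stein[OF U rp, of v x] by (intro mult_left_mono real_sqrt_le_mono) (simp_all add: D_def W(1))
  finally have main: "c * \<mu> \<le> \<mu> powr ((1 + \<delta>) / 2) * sqrt W" .
  show ?thesis
  proof (cases "\<mu> = 0")
    case True
    then show ?thesis using W0 c by (simp flip: \<mu>_def)
  next
    case False
    with \<mu> have \<mu>0: "0 < \<mu>" by simp
    have "(c * \<mu>)\<^sup>2 \<le> (\<mu> powr ((1 + \<delta>) / 2) * sqrt W)\<^sup>2"
      using main c \<mu> by (intro power_mono) auto
    also have "\<dots> = \<mu> powr (1 + \<delta>) * W"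
      using W0 by (simp add: power_mult_distrib power2_eq_square[of "\<mu> powr _"] flip: powr_add)
    finally have "\<mu> powr (1 + \<delta>) * (c\<^sup>2 * \<mu> powr (1 - \<delta>)) \<le> \<mu> powr (1 + \<delta>) * W"
      using \<mu>0 by (simp add: power_mult_distrib power2_eq_square algebra_simps flip: powr_add)
    then have "c\<^sup>2 * \<mu> powr (1 - \<delta>) \<le> W"
      using \<mu>0 by simp
    then have 1: "\<mu> powr (1 - \<delta>) \<le> W / c\<^sup>2"
      using c by (simp add: field_simps)
    have "\<mu> = \<mu> powr 1" using \<mu>0 by simp
    also have "\<dots> \<le> \<mu> powr (1 - \<delta>)"
      using \<mu>0 \<mu>1 \<delta> by (intro powr_mono') auto
    also have "\<dots> \<le> w / c\<^sup>2"
      using 1 W(2) c by (meson divide_right_mono order_trans zero_le_power2)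
    finally have 2: "\<mu> powr \<delta> \<le> (w / c\<^sup>2) powr \<delta>"
      using \<mu> \<delta> by (intro powr_mono2) auto
    \<comment> \<open>One factor keeps the true weight \<open>W\<close>, so that bounds can be added
      over blocks; the other uses only the uniform cap \<open>w\<close>.\<close>
    have "\<mu> = \<mu> powr (1 - \<delta>) * \<mu> powr \<delta>"
      using \<mu>0 by (simp flip: powr_add)
    also have "\<dots> \<le> (W / c\<^sup>2) * (w / c\<^sup>2) powr \<delta>"
      using 1 2 W0 by (intro mult_mono) auto
    finally show ?thesis by (simp add: \<mu>_def mult.commute)
  qed
qed

text \<open>Greedy packing: a block is closed once its weight exceeds \<open>\<tau>\<close>, so no
  block weighs more than \<open>2 * \<tau>\<close> and the closed blocks number at most the total
  weight over \<open>\<tau>\<close>. The last, possibly light, block accounts for the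
  \<open>+ 1\<close>.\<close>

lemma subadditive_blocks_le:
  fixes V :: "'a set \<Rightarrow> real" and w :: "'a \<Rightarrow> real"
  assumes C: "finite C" and w: "\<And>i. i \<in> C \<Longrightarrow> 0 \<le> w i" "\<And>i. i \<in> C \<Longrightarrow> w i \<le> \<tau>" and \<tau>: "0 < \<tau>"
    and sub: "\<And>A B. A \<union> B \<subseteq> C \<Longrightarrow> A \<inter> B = {} \<Longrightarrow> V (A \<union> B) \<le> V A + V B"
    and V: "V {} \<le> 0" "\<And>B. B \<subseteq> C \<Longrightarrow> sum w B \<le> 2 * \<tau> \<Longrightarrow> V B \<le> e + k * sum w B" and e: "0 \<le> e"
  shows "V C \<le> (sum w C / \<tau> + 1) * e + k * sum w C"
proof -
  \<comment> \<open>\<open>B\<close> is the block that is still being filled; the blocks that make up \<open>S - B\<close> all weigh at least \<open>\<tau>\<close>.\<close>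
  have "\<exists>B\<subseteq>S. sum w B \<le> 2 * \<tau> \<and> V (S - B) \<le> sum w (S - B) / \<tau> * e + k * sum w (S - B)"
    if "finite S" "S \<subseteq> C" for S
    using that
  proof (induction S rule: finite_induct)
    case empty
    then show ?case using V(1) \<tau> by auto
  next
    case (insert i S)
    then obtain B where B: "B \<subseteq> S" "sum w B \<le> 2 * \<tau>"
      "V (S - B) \<le> sum w (S - B) / \<tau> * e + k * sum w (S - B)" by auto
    have fB: "finite B" "i \<notin> B" using B insert finite_subset by auto
    have wi: "0 \<le> w i" "w i \<le> \<tau>" using insert w by auto
    show ?case
    proof (cases "sum w B \<le> \<tau>")
      case True
      have "insert i S - insert i B = S - B" using insert(2) by auto
      then show ?thesis
        using True B fB wi by (intro exI[of _ "insert i B"]) auto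
    next
      case False
      have S: "insert i S - {i} = S" "S = (S - B) \<union> B" using insert(2) B by auto
      have "V S \<le> V (S - B) + V B"
        using sub[of "S - B" B] S(2) insert B by auto
      also have "V B \<le> e + k * sum w B"
        using V(2) B insert by auto
      \<comment> \<open>A closed block pays the fixed cost \<open>e\<close> out of its own
        weight.\<close>
      also have "e \<le> sum w B / \<tau> * e"
        using False \<tau> e mult_right_mono[of 1 "sum w B / \<tau>" e] by simp
      finally have "V S \<le> sum w (S - B) / \<tau> * e + k * sum w (S - B) + (sum w B / \<tau> * e + k * sum w B)"
        using B(3) by linarith
      moreover have "sum w S = sum w (S - B) + sum w B"
        using insert(1) B(1) by (simp add: sum.subset_diff)
      ultimately have "V S \<le> sum w S / \<tau> * e + k * sum w S"
        by (simp add: algebra_simps add_divide_distrib)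
      then show ?thesis
        using S(1) wi \<tau> by (intro exI[of _ "{i}"]) auto
    qed
  qed
  then obtain B where B: "B \<subseteq> C" "sum w B \<le> 2 * \<tau>"
      "V (C - B) \<le> sum w (C - B) / \<tau> * e + k * sum w (C - B)" using C by blast
  have "V C \<le> V (C - B) + V B"
    using sub[of "C - B" B] B(1) by (simp add: Un_absorb2 Int_commute)
  also have "V B \<le> e + k * sum w B"
    using V(2) B by auto
  finally have "V C \<le> sum w (C - B) / \<tau> * e + k * sum w (C - B) + (e + k * sum w B)"
    using B(3) by linarith
  moreover have s: "sum w C = sum w (C - B) + sum w B"
    using C B(1) by (simp add: sum.subset_diff)
  moreover have "0 \<le> sum w B / \<tau> * e"
    using e \<tau> w(1) B(1) by (intro mult_nonneg_nonneg divide_nonneg_pos sum_nonneg) auto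
  ultimately show ?thesis
    by (simp add: algebra_simps add_divide_distrib)
qed

section \<open>Freezing the coordinates outside a junta\<close>

lemma avg_agree:
  assumes "finite S" "\<And>i. i \<notin> S \<Longrightarrow> x i = y i"
  shows "avg p S F x = avg p S F y"
  using assms
proof (induction S arbitrary: x y rule: finite_induct)
  case empty
  then have "x = y" by (simp add: fun_eq_iff)
  then show ?case by simp
next
  case (insert k S)
  have "avg p S F (x(k := b)) = avg p S F (y(k := b))" for b
    using insert.prems by (intro insert.IH) auto
  then show ?case
    by (simp only: avg_insert[OF insert.hyps] avg1_def)
qed

text \<open>Only points that agree with \<open>x\<close> outside \<open>S\<close> are ever
  evaluated. With the all-\<open>False\<close> base point this confines the evaluations to the
  cube.\<close>

lemma avg_cong_outside:
  assumes "finite S" "\<And>y. (\<And>i. i \<notin> S \<Longrightarrow> y i = x i) \<Longrightarrow> F y = G y"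
  shows "avg p S F x = avg p S G x"
  using assms
proof (induction S arbitrary: x rule: finite_induct)
  case empty
  then show ?case by auto
next
  case (insert k S)
  have "avg p S F (x(k := b)) = avg p S G (x(k := b))" for b
    using insert.prems by (intro insert.IH) (metis fun_upd_other insert_iff)
  then show ?case
    by (simp only: avg_insert[OF insert.hyps] avg1_def)
qed

definition glue :: "'a set \<Rightarrow> ('a \<Rightarrow> bool) \<Rightarrow> ('a \<Rightarrow> bool) \<Rightarrow> 'a \<Rightarrow> bool" where
  "glue J w x = (\<lambda>i. if i \<in> J then w i else x i)"

lemma glue_upd_inside: "k \<in> J \<Longrightarrow> glue J w (x(k := b)) = glue J w x"
  by (auto simp: glue_def)

lemma glue_upd_outside: "k \<notin> J \<Longrightarrow> glue J w (x(k := b)) = (glue J w x)(k := b)"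
  by (simp add: glue_def fun_upd_def fun_eq_iff)

lemma avg_glue:
  assumes "finite S" "S \<inter> J = {}"
  shows "avg p S (\<lambda>y. F (glue J w y)) x = avg p S F (glue J w x)"
  using assms
proof (induction S arbitrary: x rule: finite_induct)
  case (insert k S)
  have "avg p S (\<lambda>y. F (glue J w y)) (x(k := b)) = avg p S F ((glue J w x)(k := b))" for b
    using insert glue_upd_outside[of k J w x b] by (metis disjoint_insert(1) insert_disjoint(1))
  then show ?case
    by (simp only: avg_insert[OF insert.hyps] avg1_def)
qed simp

text \<open>The \<open>J\<close>-part of \<open>y\<close> is overwritten, so its average is vacuous.
  Outside \<open>U\<close> the averaged points keep the values of \<open>x\<close>, so
  \<open>w\<close> has to agree with \<open>x\<close> there.\<close>

lemma avg_glue_superset: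
  assumes "finite U" "J \<subseteq> U" "\<And>i. i \<notin> U \<Longrightarrow> w i = x i"
  shows "avg p U (\<lambda>y. F (glue J w y)) x = avg p (U - J) F w"
proof -
  have fin: "finite (U - J)" "finite J" using assms finite_subset by auto
  have U: "(U - J) \<union> J = U" "(U - J) \<inter> J = {}" using assms by auto
  have "avg p U (\<lambda>y. F (glue J w y)) x = avg p (U - J) (avg p J (\<lambda>y. F (glue J w y))) x"
    using avg_union[OF fin U(2)] U(1) by metis
  also have "avg p J (\<lambda>y. F (glue J w y)) = (\<lambda>y. F (glue J w y))"
    by (intro ext avg_invariant) (simp add: glue_upd_inside)
  also have "avg p (U - J) (\<lambda>y. F (glue J w y)) x = avg p (U - J) F (glue J w x)"
    using fin(1) U(2) by (rule avg_glue)
  also have "\<dots> = avg p (U - J) F w"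
    using assms by (intro avg_agree fin) (auto simp: glue_def)
  finally show ?thesis .
qed

text \<open>Either value of a bit has probability at least \<open>\<zeta>\<close>, so every pattern
  on \<open>J\<close> has probability at least \<open>\<zeta> ^ card J\<close>.\<close>

lemma avg_atom_le:
  assumes "finite J" and F: "\<And>x. 0 \<le> F x" and p: "\<zeta> \<le> p" "p \<le> 1 - \<zeta>" "0 \<le> \<zeta>"
  shows "\<zeta> ^ card J * F (glue J w x) \<le> avg p J F x"
  using assms(1)
proof (induction J arbitrary: x rule: finite_induct)
  case empty
  then show ?case by (simp add: glue_def)
next
  case (insert k J)
  have nn: "0 \<le> avg p J F y" for y using p F by (intro avg_nonneg) auto
  have g: "glue (insert k J) w x = glue J w (x(k := w k))"
    using insert(2) by (auto simp: glue_def)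
  have "\<zeta> ^ card (insert k J) * F (glue (insert k J) w x) = \<zeta> * (\<zeta> ^ card J * F (glue J w (x(k := w k))))"
    using insert(1,2) by (simp add: g)
  also have "\<dots> \<le> \<zeta> * avg p J F (x(k := w k))"
    using insert.IH p by (intro mult_left_mono) auto
  also have "\<dots> \<le> p * avg p J F (x(k := True)) + (1 - p) * avg p J F (x(k := False))"
  proof (cases "w k")
    case True
    then show ?thesis
      using mult_right_mono[OF p(1) nn[of "x(k := True)"]] mult_nonneg_nonneg[OF _ nn[of "x(k := False)"], of "1 - p"] p
      by simp
  next
    case False
    then show ?thesis
      using mult_right_mono[of \<zeta> "1 - p", OF _ nn[of "x(k := False)"]] mult_nonneg_nonneg[OF _ nn[of "x(k := True)"], of p] p
      by simp
  qed
  finally show ?case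
    by (simp only: avg_insert[OF insert.hyps] avg1_def)
qed

lemma avg_less_witness:
  assumes "avg p S F x < c" "0 \<le> p" "p \<le> 1"
  shows "\<exists>y. F y < c"
proof (rule ccontr)
  assume "\<not> ?thesis"
  then have "avg p S (\<lambda>_. c) x \<le> avg p S F x"
    using assms by (intro avg_mono) (auto simp: not_less)
  then show False using assms by (simp add: avg_const)
qed

text \<open>Given the \<open>J\<close>-part of \<open>x\<close>, \<open>g x\<close> and
  \<open>g (glue J x y)\<close> are independent bits with the same mean \<open>A\<close>; they
  differ with probability \<open>2 * A * (1 - A)\<close>, twice the conditional variance.\<close>

lemma avg_avg_glue_neq:
  fixes g :: "('a \<Rightarrow> bool) \<Rightarrow> bool"
  assumes "finite U" "J \<subseteq> U"
  shows "avg p U (\<lambda>y. avg p U (\<lambda>x. of_bool (g x \<noteq> g (glue J x y))) z) z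
    = 2 * avg p U (\<lambda>x. (of_bool (g x) - avg p (U - J) (\<lambda>x. of_bool (g x)) x)\<^sup>2) z"
proof -
  define G :: "('a \<Rightarrow> bool) \<Rightarrow> real" where "G = (\<lambda>x. of_bool (g x))"
  define A where "A = avg p (U - J) G"
  have fin: "finite (U - J)" using assms by auto
  have neq: "of_bool (g x \<noteq> g y) = G x + (1 - 2 * G x) * G y" for x y
    by (auto simp: G_def)
  have "avg p U (\<lambda>y. avg p U (\<lambda>x. of_bool (g x \<noteq> g (glue J x y))) z) z
     = avg p U (\<lambda>x. avg p U (\<lambda>y. G x + (1 - 2 * G x) * G (glue J x y)) z) z"
    unfolding neq by (rule avg_commute_avg)
  also have "\<dots> = avg p U (\<lambda>x. G x + (1 - 2 * G x) * A x) z"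
    using assms
    by (intro avg_cong_outside) (simp_all add: avg_add avg_cmult avg_const avg_glue_superset A_def)
  also have "\<dots> = avg p U (\<lambda>x. G x + (A x - 2 * (G x * A x))) z"
    by (simp add: algebra_simps)
  also have "\<dots> = avg p U G z + avg p U A z - 2 * avg p U (\<lambda>x. G x * A x) z"
    by (simp add: avg_add avg_diff avg_cmult)
  also have "avg p U A z = avg p U G z"
    using assms by (simp add: A_def avg_avg_subset)
  also have "avg p U (\<lambda>x. G x * A x) z = avg p U (\<lambda>x. (A x)\<^sup>2) z"
  proof -
    have "avg p U (\<lambda>x. G x * A x) z = avg p U (avg p (U - J) (\<lambda>x. A x * G x)) z"
      using assms by (simp add: avg_avg_subset mult.commute)
    also have "avg p (U - J) (\<lambda>x. A x * G x) = (\<lambda>x. A x * avg p (U - J) G x)"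
      unfolding A_def by (intro ext avg_mult_left avg_upd_inside fin)
    finally show ?thesis by (simp add: A_def power2_eq_square)
  qed
  also have "avg p U G z = avg p U (\<lambda>x. (G x)\<^sup>2) z"
    by (rule arg_cong[of _ _ "\<lambda>F. avg p U F z"]) (auto simp: G_def fun_eq_iff)
  finally show ?thesis
    using assms avg_square_deviation_subset[of U "U - J" p G z] by (simp add: G_def A_def)
qed

lemma monotone_junta_selection:
  fixes g P :: "('a \<Rightarrow> bool) \<Rightarrow> bool"
  assumes U: "finite U" "J \<subseteq> U" and p: "\<zeta> \<le> p" "p \<le> 1 - \<zeta>" "0 < \<zeta>"
    and step: "\<And>x i. i \<in> J \<Longrightarrow> \<not> P (x(i := False)) \<Longrightarrow> \<not> P (x(i := True))
      \<Longrightarrow> g (x(i := False)) \<Longrightarrow> g (x(i := True))"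
    and small: "2 * avg p U (\<lambda>x. (of_bool (g x) - avg p (U - J) (\<lambda>x. of_bool (g x)) x)\<^sup>2) z
      + \<epsilon> * avg p U (\<lambda>x. of_bool (P x)) z / \<zeta> ^ card J < \<epsilon>"
    and \<epsilon>: "0 < \<epsilon>"
  shows "\<exists>h. mono h \<and> (\<forall>x y. (\<forall>i\<in>J. x i = y i) \<longrightarrow> h x = h y)
    \<and> avg p U (\<lambda>x. of_bool (g x \<noteq> h x)) z \<le> \<epsilon>"
proof -
  have J: "finite J" using U finite_subset by auto
  have p01: "0 \<le> p" "p \<le> 1" using p by auto
  define M :: "('a \<Rightarrow> bool) \<Rightarrow> real" where "M = (\<lambda>y. of_bool (\<exists>w. P (glue J w y)))"
  define W where "W = (\<lambda>y. avg p U (\<lambda>x. of_bool (g x \<noteq> g (glue J x y))) z)"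
  \<comment> \<open>A single bad pattern \<open>w\<close> already has probability at least
    \<open>\<zeta> ^ card J\<close> within the slice.\<close>
  have M: "M y \<le> avg p J (\<lambda>x. of_bool (P x)) y / \<zeta> ^ card J" for y
  proof (cases "\<exists>w. P (glue J w y)")
    case True
    then obtain w where "P (glue J w y)" by auto
    then have "\<zeta> ^ card J * 1 \<le> avg p J (\<lambda>x. of_bool (P x)) y"
      using avg_atom_le[OF J, of "\<lambda>x. of_bool (P x)" \<zeta> p w y] p by simp
    then show ?thesis
      using True p by (simp add: M_def field_simps)
  next
    case False
    then show ?thesis
      unfolding M_def using p by (auto intro!: divide_nonneg_nonneg avg_nonneg)
  qed
  have "avg p U M z \<le> avg p U (\<lambda>y. (1 / \<zeta> ^ card J) * avg p J (\<lambda>x. of_bool (P x)) y) z"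
    using M by (intro avg_mono p01) simp
  also have "\<dots> = avg p U (\<lambda>x. of_bool (P x)) z / \<zeta> ^ card J"
    unfolding avg_cmult avg_avg_subset[OF U] by simp
  finally have "\<epsilon> * avg p U M z \<le> \<epsilon> * (avg p U (\<lambda>x. of_bool (P x)) z / \<zeta> ^ card J)"
    using \<epsilon> by (intro mult_left_mono) auto
  then have "avg p U (\<lambda>y. W y + \<epsilon> * M y) z < \<epsilon>"
    using small unfolding avg_add avg_cmult W_def avg_avg_glue_neq[OF U] by simp
  then obtain y where y: "W y + \<epsilon> * M y < \<epsilon>"
    using avg_less_witness p01 by blast
  have "0 \<le> W y" unfolding W_def by (intro avg_nonneg p01) auto
  with y have "\<epsilon> * M y < \<epsilon>" by linarith
  then have M0: "\<not> P (glue J w y)" for w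
    using \<epsilon> by (auto simp: M_def split: if_splits)
  have W: "W y \<le> \<epsilon>"
    using y \<epsilon> by (auto simp: M_def of_bool_def split: if_splits)
  define h where "h = (\<lambda>x. g (glue J x y))"
  \<comment> \<open>Coordinates are raised one at a time; every intermediate point lies on the same
    slice and so avoids \<open>P\<close>.\<close>
  have raise: "g (glue J (\<lambda>i. i \<in> S \<or> x i) y)" if "finite S" "S \<subseteq> J" "g (glue J x y)" for S x
    using that
  proof (induction S rule: finite_induct)
    case (insert i S)
    define X where "X = glue J (\<lambda>i. i \<in> S \<or> x i) y"
    have X1: "X(i := True) = glue J (\<lambda>j. j \<in> insert i S \<or> x j) y"
      using insert by (auto simp: X_def glue_def fun_eq_iff)
    have "g X" using insert by (simp add: X_def)
    have "g (X(i := True))"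
    proof (cases "X i")
      case True
      then have "X(i := True) = X" by (auto simp: fun_eq_iff)
      then show ?thesis using \<open>g X\<close> by simp
    next
      case False
      then have X0: "X(i := False) = X" by (auto simp: fun_eq_iff)
      show ?thesis
      proof (rule step)
        show "i \<in> J" using insert.prems by simp
        show "\<not> P (X(i := False))" unfolding X0 by (simp add: X_def M0)
        show "\<not> P (X(i := True))" unfolding X1 by (rule M0)
        show "g (X(i := False))" using X0 \<open>g X\<close> by simp
      qed
    qed
    then show ?case unfolding X1 .
  qed simp
  have "mono h"
  proof (intro monoI le_boolI)
    fix x x' assume le: "x \<le> x'" and "h x"
    have "g (glue J (\<lambda>i. i \<in> {i\<in>J. x' i} \<or> x i) y)"
      using \<open>h x\<close> J by (intro raise) (auto simp: h_def)
    moreover have "glue J (\<lambda>i. i \<in> {i\<in>J. x' i} \<or> x i) y = glue J x' y"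
      using le by (auto simp: glue_def fun_eq_iff le_fun_def)
    ultimately show "h x'" by (simp add: h_def)
  qed
  moreover have "h x = h x'" if "\<forall>i\<in>J. x i = x' i" for x x'
  proof -
    have "glue J x y = glue J x' y" using that by (auto simp: glue_def)
    then show ?thesis by (simp add: h_def)
  qed
  moreover have "avg p U (\<lambda>x. of_bool (g x \<noteq> h x)) z \<le> \<epsilon>"
    using W by (simp add: W_def h_def)
  ultimately show ?thesis by blast
qed

section \<open>Monotone juntas\<close>

lemma expectation_Pi_pmf_bernoulli:
  fixes F :: "('a \<Rightarrow> bool) \<Rightarrow> real"
  assumes "finite S" "0 \<le> p" "p \<le> 1"
  shows "measure_pmf.expectation (Pi_pmf S False (\<lambda>_. bernoulli_pmf p)) F = avg p S F (\<lambda>_. False)"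
  using assms(1)
proof (induction S arbitrary: F rule: finite_induct)
  case empty
  then show ?case by simp
next
  case (insert k S)
  let ?Q = "Pi_pmf S False (\<lambda>_. bernoulli_pmf p)"
  have fin: "finite (set_pmf ?Q)"
    using insert(1) by (intro finite_subset[OF set_Pi_pmf_subset'] finite_PiE_dflt) auto
  have "measure_pmf.expectation (Pi_pmf (insert k S) False (\<lambda>_. bernoulli_pmf p)) F
     = p * avg p S (\<lambda>y. F (y(k := True))) (\<lambda>_. False) + (1 - p) * avg p S (\<lambda>y. F (y(k := False))) (\<lambda>_. False)"
    using insert(1,2) fin assms
    by (simp add: Pi_pmf_insert' pmf_expectation_bind[of UNIV] flip: map_pmf_def)
       (simp add: UNIV_bool insert.IH)
  then show ?case
    by (simp only: avg_insert_slices[OF insert.hyps])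
qed

text \<open>The implication keeps the AND away from coordinates outside \<open>S\<close>, so that
  the induction on \<open>S\<close> can start from the identity.\<close>

lemma avg_and_eq_thin:
  assumes "finite S"
  shows "avg \<rho> S (\<lambda>z. f (\<lambda>i. x i \<and> (i \<in> S \<longrightarrow> z i))) y = thin \<rho> S f x"
  using assms
proof (induction S arbitrary: x rule: finite_induct)
  case (insert k S)
  have T: "(\<lambda>i. x i \<and> (i \<in> insert k S \<longrightarrow> (z(k := True)) i)) = (\<lambda>i. x i \<and> (i \<in> S \<longrightarrow> z i))" for z
    using insert(2) by (auto simp: fun_eq_iff)
  have F: "(\<lambda>i. x i \<and> (i \<in> insert k S \<longrightarrow> (z(k := False)) i)) = (\<lambda>i. (x(k := False)) i \<and> (i \<in> S \<longrightarrow> z i))" for z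
    using insert(2) by (auto simp: fun_eq_iff)
  show ?case
    by (simp only: avg_insert_slices[OF insert.hyps] T F insert.IH thin_insert[OF insert.hyps] thin1_def)
qed simp

text \<open>With probability \<open>1 - \<rho>\<close> the raised bit is thinned away, and then
  \<open>f\<close> sees the same points as from \<open>x(i := False)\<close>; the rest is
  nonnegative.\<close>

lemma thin_raise_ge:
  assumes "finite U" "i \<in> U" "0 \<le> \<rho>" "\<rho> \<le> 1" and f: "\<And>x. 0 \<le> f x"
  shows "(1 - \<rho>) * thin \<rho> U f (x(i := False)) \<le> thin \<rho> U f (x(i := True))"
proof -
  obtain T where T: "U = insert i T" "i \<notin> T" "finite T"
    using assms by (metis finite_insert mk_disjoint_insert)
  have "thin \<rho> T (\<lambda>x. 0 * f x) y \<le> thin \<rho> T f y" for y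
    using assms by (intro thin_mono) auto
  then have "0 \<le> thin \<rho> T f y" for y
    unfolding thin_cmult by simp
  then show ?thesis
    using T assms by (simp add: thin_insert thin1_def algebra_simps)
qed

section \<open>The junta theorem for averages and thinning\<close>

theorem one_sided_error_solutions_near_monotone_junta:
  fixes \<epsilon> \<zeta> :: real
  assumes \<epsilon>: "0 < \<epsilon>" and \<zeta>: "0 < \<zeta>"
  shows "\<exists>\<eta>>0. \<exists>N::nat. \<forall>p\<in>{\<zeta>..1 - \<zeta>}. \<forall>\<rho>\<in>{\<zeta>..1 - \<zeta>}. \<forall>l\<ge>\<zeta>.
    \<forall>(U::'a set) f g z. finite U \<longrightarrow> (\<forall>x. f x \<in> {0..1}) \<longrightarrow>
      avg p U (\<lambda>x. (1 - of_bool (g x)) * thin \<rho> U f x) z \<le> \<eta> \<longrightarrow>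
      avg p U (\<lambda>x. of_bool (g x \<and> thin \<rho> U f x \<le> l)) z \<le> \<eta> \<longrightarrow>
      (\<exists>h J. J \<subseteq> U \<and> card J \<le> N \<and> mono h \<and> (\<forall>x y. (\<forall>i\<in>J. x i = y i) \<longrightarrow> h x = h y)
         \<and> avg p U (\<lambda>x. of_bool (g x \<noteq> h x)) z \<le> \<epsilon>)"
proof -
  \<comment> \<open>\<open>4 * c = \<zeta>\<close> is at most every admissible \<open>l\<close>;
    \<open>\<delta>\<close> is read off from \<open>gap\<close> and \<open>K\<close> from
    \<open>\<sigma> * p * (1 - \<sigma>) \<ge> \<zeta> ^ 3 / 2\<close>; \<open>\<kappa>\<close> is
    at most both \<open>c\<close> and \<open>\<zeta>\<^sup>2\<close>. The choice of
    \<open>\<tau>\<close> makes the cost per unit of influence \<open>\<epsilon> / (8 * K)\<close>,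
    \<open>m\<close> collects the coefficients of the exceptional measure, and \<open>\<eta>\<close>
    makes their contribution at most \<open>\<epsilon> / 4\<close>.\<close>
  define c where "c = \<zeta> / 4"
  define \<delta> where "\<delta> = \<zeta> ^ 3 / 8"
  define K where "K = 2 / \<zeta> ^ 3"
  define \<kappa> where "\<kappa> = \<zeta>\<^sup>2 / 4"
  define \<tau> where "\<tau> = c\<^sup>2 / 2 * (\<epsilon> * c\<^sup>2 / (8 * K)) powr (1 / \<delta>)"
  define N where "N = nat \<lceil>K / \<tau>\<rceil>"
  define m where "m = 2 * (K / \<tau> + 1) + \<epsilon> / \<zeta> ^ N"
  define \<eta> where "\<eta> = \<epsilon> / (4 * m * (1 + 1 / \<kappa>))"
  have pos: "0 < c" "0 < \<delta>" "0 < K" "0 < \<kappa>" "0 < \<tau>"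
    using \<zeta> \<epsilon> by (simp_all add: c_def \<delta>_def K_def \<kappa>_def \<tau>_def)
  then have m: "0 < m"
    unfolding m_def using \<epsilon> \<zeta>
    by (intro add_pos_pos mult_pos_pos divide_pos_pos zero_less_power) simp_all
  then have \<eta>: "0 < \<eta>"
    unfolding \<eta>_def using \<epsilon> pos m
    by (intro divide_pos_pos mult_pos_pos add_pos_pos) simp_all
  have \<tau>: "(2 * \<tau> / c\<^sup>2) powr \<delta> / c\<^sup>2 = \<epsilon> / (8 * K)"
  proof -
    have "2 * \<tau> / c\<^sup>2 = (\<epsilon> * c\<^sup>2 / (8 * K)) powr (1 / \<delta>)"
      using pos by (simp add: \<tau>_def)
    then have "(2 * \<tau> / c\<^sup>2) powr \<delta> = \<epsilon> * c\<^sup>2 / (8 * K)"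
      using pos \<epsilon> by (simp add: powr_powr)
    then show ?thesis using pos by simp
  qed
  have "\<exists>h J. J \<subseteq> U \<and> card J \<le> N \<and> mono h \<and> (\<forall>x y. (\<forall>i\<in>J. x i = y i) \<longrightarrow> h x = h y)
         \<and> avg p U (\<lambda>x. of_bool (g x \<noteq> h x)) z \<le> \<epsilon>"
    if p: "\<zeta> \<le> p" "p \<le> 1 - \<zeta>" and \<rho>: "\<zeta> \<le> \<rho>" "\<rho> \<le> 1 - \<zeta>" and l: "\<zeta> \<le> l"
      and U: "finite U" and f: "\<And>x. 0 \<le> f x" "\<And>x. f x \<le> 1"
      and err1: "avg p U (\<lambda>x. (1 - of_bool (g x)) * thin \<rho> U f x) z \<le> \<eta>"
      and err2: "avg p U (\<lambda>x. of_bool (g x \<and> thin \<rho> U f x \<le> l)) z \<le> \<eta>"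
    for p \<rho> l f g z and U :: "'a set"
  proof -
    have \<zeta>2: "\<zeta> \<le> 1 / 2" using p by linarith
    have p01: "0 \<le> p" "p \<le> 1" and \<rho>01: "0 \<le> \<rho>" "\<rho> \<le> 1" using p \<rho> \<zeta> by auto
    define \<sigma> where "\<sigma> = sqrt \<rho>"
    have \<sigma>\<sigma>: "\<sigma> * \<sigma> = \<rho>" using \<rho>01 by (simp add: \<sigma>_def)
    have \<sigma>01: "0 \<le> \<sigma>" "\<sigma> \<le> 1" using \<rho>01 by (simp_all add: \<sigma>_def)
    have "\<sigma> * \<sigma> \<le> \<sigma> * 1" using \<sigma>01 by (intro mult_left_mono) auto
    then have \<sigma>\<zeta>: "\<zeta> \<le> \<sigma>" using \<sigma>\<sigma> \<rho> by simp
    have e: "(1 - \<sigma>) * (1 + \<sigma>) = 1 - \<rho>" using \<sigma>\<sigma> by (simp add: algebra_simps)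
    \<comment> \<open>Since \<open>1 + \<sigma> \<le> 2\<close>, passing to the square root costs at
      most a factor \<open>2\<close> in the distance to \<open>1\<close>.\<close>
    have "1 - \<rho> \<le> (1 - \<sigma>) * 2"
      unfolding e[symmetric] using \<sigma>01 by (intro mult_left_mono) auto
    then have \<sigma>2: "\<zeta> / 2 \<le> 1 - \<sigma>" using \<rho> by (simp add: field_simps)
    have \<sigma>p01: "0 \<le> \<sigma> * p" "\<sigma> * p \<le> 1" using \<sigma>01 p01 by (auto intro: mult_le_one)
    have \<sigma>p: "\<sigma> * p < 1"
      using mult_left_le[of p \<sigma>] p01 \<sigma>01 \<sigma>2 \<zeta> by linarith
    have \<sigma>\<sigma>p: "\<sigma> * (\<sigma> * p) \<le> 1" "0 \<le> \<sigma> * (\<sigma> * p)" using \<sigma>01 \<sigma>p01 by (auto intro: mult_le_one)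
    have \<delta>1: "\<delta> \<le> 1"
      using power_le_one[of \<zeta> 3] \<zeta> \<zeta>2 by (simp add: \<delta>_def)
    have gap: "4 * \<delta> * (1 - \<sigma> * p) \<le> p * (1 - p) * (1 - \<sigma>)"
    proof -
      have "4 * \<delta> * (1 - \<sigma> * p) \<le> 4 * \<delta> * 1"
        using pos \<sigma>p01 by (intro mult_left_mono) auto
      also have "\<dots> = \<zeta> * \<zeta> * (\<zeta> / 2)" by (simp add: \<delta>_def power3_eq_cube)
      also have "\<dots> \<le> p * (1 - p) * (1 - \<sigma>)"
        using p \<sigma>2 \<zeta> p01 by (intro mult_mono) auto
      finally show ?thesis .
    qed
    define u where "u = thin \<rho> U f"
    define v where "v = thin \<sigma> U f"
    have u: "u = thin \<sigma> U v" by (simp add: u_def v_def thin_thin \<sigma>\<sigma>)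
    have "thin \<rho> U (\<lambda>x. 0 * f x) y \<le> u y" for y
      unfolding u_def using f \<rho>01 by (intro thin_mono) auto
    then have u0: "0 \<le> u y" for y unfolding thin_cmult by simp

    \<comment> \<open>The bias \<open>\<sigma> * p\<close> is that of a \<open>p\<close>-biased
      point after one thinning by \<open>\<sigma>\<close>.\<close>
    define I where "I = (\<lambda>i. avg (\<sigma> * p) U (\<lambda>y. (cdiff i v y)\<^sup>2) z)"
    have I0: "0 \<le> I i" for i unfolding I_def using \<sigma>p01 by (intro avg_nonneg) auto
    have IK: "sum I U \<le> K"
    proof -
      have "\<zeta> * \<zeta> * (\<zeta> / 2) * sum I U \<le> \<sigma> * p * (1 - \<sigma>) * sum I U"
        using \<zeta> p \<sigma>2 \<sigma>\<zeta> \<sigma>p01 I0 by (intro mult_right_mono mult_mono sum_nonneg) auto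
      also have "\<dots> \<le> avg (\<sigma> * p) U (\<lambda>x. (v x)\<^sup>2) z + \<sigma> * p * (1 - \<sigma>) * sum I U"
        using \<sigma>p01 by (simp add: avg_nonneg)
      also have "\<dots> \<le> avg (\<sigma> * (\<sigma> * p)) U (\<lambda>x. (f x)\<^sup>2) z"
        using thin_energy[OF U \<sigma>p01 \<sigma>01, of f z] by (simp add: I_def v_def)
      also have "\<dots> \<le> avg (\<sigma> * (\<sigma> * p)) U (\<lambda>x. 1) z"
        using f \<sigma>\<sigma>p by (intro avg_mono) (auto simp: power_le_one)
      finally have "\<zeta> ^ 3 / 2 * sum I U \<le> 1" by (simp add: avg_const power3_eq_cube mult.assoc)
      then show ?thesis using \<zeta> by (simp add: K_def field_simps)
    qed
    define J where "J = {i\<in>U. \<tau> < I i}"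
    have J: "J \<subseteq> U" "finite J" using U by (auto simp: J_def)
    have "of_nat (card J) * \<tau> \<le> sum I J"
      by (intro sum_bounded_below) (auto simp: J_def)
    also have "\<dots> \<le> sum I U" using U J I0 by (intro sum_mono2) auto
    finally have "card J \<le> K / \<tau>"
      using IK pos by (simp add: field_simps)
    then have cardJ: "card J \<le> N" unfolding N_def by linarith

    define P where "P = (\<lambda>x. g x \<and> u x \<le> l \<or> \<not> g x \<and> \<kappa> \<le> u x)"
    define a where "a = avg p U (\<lambda>x. of_bool (P x)) z"
    have a0: "0 \<le> a" unfolding a_def using p01 by (intro avg_nonneg) auto
    \<comment> \<open>Markov: where \<open>g\<close> fails and \<open>u\<close> reaches
      \<open>\<kappa>\<close>, the integrand of the first error is at least
      \<open>\<kappa>\<close>.\<close>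
    have a: "a \<le> \<eta> * (1 + 1 / \<kappa>)"
    proof -
      have "a \<le> avg p U (\<lambda>x. of_bool (g x \<and> u x \<le> l) + (1 / \<kappa>) * ((1 - of_bool (g x)) * u x)) z"
        unfolding a_def
      proof (intro avg_mono p01)
        fix x
        show "of_bool (P x) \<le> of_bool (g x \<and> u x \<le> l) + (1 / \<kappa>) * ((1 - of_bool (g x)) * u x)"
          using u0[of x] pos by (cases "g x") (auto simp: P_def field_simps of_bool_def)
      qed
      also have "\<dots> \<le> \<eta> + (1 / \<kappa>) * \<eta>"
        unfolding avg_add avg_cmult using err1 err2 pos
        by (intro add_mono mult_left_mono) (auto simp: u_def)
      finally show ?thesis by (simp add: algebra_simps)
    qed
    have \<kappa>c: "\<kappa> \<le> c"
      using \<zeta> \<zeta>2 by (simp add: \<kappa>_def c_def power2_eq_square mult_left_le)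
    have P: "4 * c < u x" if "\<not> P x" "g x" for x
      using that l by (auto simp: P_def c_def)
    have P': "u x < c" if "\<not> P x" "\<not> g x" for x
      using that \<kappa>c by (auto simp: P_def)
    define V where "V = (\<lambda>B. avg p U (\<lambda>y. (of_bool (g y) - avg p B (\<lambda>y. of_bool (g y)) y)\<^sup>2) z)"
    \<comment> \<open>Each block costs \<open>a\<close> for the exceptional points and
      \<open>\<epsilon> / (8 * K)\<close> per unit of influence. Packing applies because coordinates
      off \<open>J\<close> have influence at most \<open>\<tau>\<close>.\<close>
    have "V (U - J) \<le> (sum I (U - J) / \<tau> + 1) * a + \<epsilon> / (8 * K) * sum I (U - J)"
    proof (rule subadditive_blocks_le[OF _ _ _ pos(5)])
      show "V (A \<union> B) \<le> V A + V B" if "A \<union> B \<subseteq> U - J" "A \<inter> B = {}" for A B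
        unfolding V_def using that U p01 by (intro avg_square_deviation_union_le) auto
      show "V B \<le> a + \<epsilon> / (8 * K) * sum I B" if B: "B \<subseteq> U - J" "sum I B \<le> 2 * \<tau>" for B
      proof -
        have BU: "B \<subseteq> U" using B by auto
        have "V B \<le> a + avg p U (\<lambda>y. of_bool (c \<le> \<bar>u y - avg p B u y\<bar>)) z"
          unfolding V_def a_def by (intro threshold_square_deviation_le U BU p01 P P' pos)
        also have "\<dots> \<le> a + (2 * \<tau> / c\<^sup>2) powr \<delta> / c\<^sup>2 * sum I B"
          using prob_large_deviation_le[OF U BU p01 \<sigma>01 _ \<delta>1 \<sigma>p gap pos(1) u _ B(2), of z] pos
          by (simp add: I_def)
        finally show ?thesis unfolding \<tau> .
      qed
    qed (use U I0 a0 in \<open>auto simp: J_def V_def avg_const\<close>)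
    also have "\<dots> \<le> (K / \<tau> + 1) * a + \<epsilon> / (8 * K) * K"
    proof -
      have "sum I (U - J) \<le> K"
        using sum_mono2[OF U, of "U - J" I] I0 IK by auto
      then show ?thesis
        using pos a0 \<epsilon> by (intro add_mono mult_right_mono mult_left_mono divide_right_mono) auto
    qed
    finally have V: "V (U - J) \<le> (K / \<tau> + 1) * a + \<epsilon> / 8"
      using pos by simp
    \<comment> \<open>\<open>m\<close> is built from \<open>N\<close> instead of
      \<open>card J\<close>, since \<open>\<eta>\<close> has to be fixed before \<open>J\<close> is
      known.\<close>
    have "\<zeta> ^ N \<le> \<zeta> ^ card J"
      using cardJ \<zeta> \<zeta>2 by (intro power_decreasing) auto
    then have "\<epsilon> * a / \<zeta> ^ card J \<le> \<epsilon> * a / \<zeta> ^ N"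
      using \<zeta> \<epsilon> a0 by (intro divide_left_mono) auto
    then have "2 * V (U - J) + \<epsilon> * a / \<zeta> ^ card J \<le> m * a + \<epsilon> / 4"
      using V by (simp add: m_def algebra_simps)
    also have "m * a \<le> m * (\<eta> * (1 + 1 / \<kappa>))"
      using a m by (intro mult_left_mono) auto
    also have "\<dots> = \<epsilon> / 4"
    proof -
      have "m * (\<epsilon> / (4 * m * r) * r) = \<epsilon> / 4" if "0 < r" for r
        using that m by (simp add: field_simps)
      moreover have "0 < 1 + 1 / \<kappa>" using pos by (simp add: add_pos_pos)
      ultimately show ?thesis unfolding \<eta>_def .
    qed
    finally have small: "2 * V (U - J) + \<epsilon> * a / \<zeta> ^ card J < \<epsilon>"
      using \<epsilon> by linarith
    have "\<exists>h. mono h \<and> (\<forall>x y. (\<forall>i\<in>J. x i = y i) \<longrightarrow> h x = h y)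
        \<and> avg p U (\<lambda>x. of_bool (g x \<noteq> h x)) z \<le> \<epsilon>"
    proof (rule monotone_junta_selection[OF U J(1) p \<zeta> _ small[unfolded V_def a_def] \<epsilon>])
      \<comment> \<open>At the lower point \<open>u > l \<ge> \<zeta>\<close>, so at the upper one
        \<open>u \<ge> \<zeta> * \<zeta> \<ge> \<kappa>\<close>; not being exceptional, the upper
        point must satisfy \<open>g\<close>.\<close>
      fix x i
      assume i: "i \<in> J" and *: "\<not> P (x(i := False))" "\<not> P (x(i := True))" "g (x(i := False))"
      have "\<kappa> \<le> \<zeta> * \<zeta>" by (simp add: \<kappa>_def power2_eq_square)
      also have "\<dots> \<le> (1 - \<rho>) * u (x(i := False))"
        using *(1,3) l \<rho> \<zeta> by (intro mult_mono) (auto simp: P_def)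
      also have "\<dots> \<le> u (x(i := True))"
        unfolding u_def using i J U \<rho>01 f by (intro thin_raise_ge) auto
      finally show "g (x(i := True))" using *(2) by (auto simp: P_def)
    qed
    then show ?thesis using J cardJ by blast
  qed
  note near = this
  show ?thesis
  proof (intro exI[of _ \<eta>] exI[of _ N] conjI \<eta> ballI allI impI, goal_cases)
    case (1 p \<rho> l U f g z)
    then show ?case
      by (intro near[where \<rho> = \<rho> and l = l and f = f]) auto
  qed
qed

section \<open>Transfer to the biased cube\<close>

theorem theorem2p11:
  fixes \<epsilon> \<zeta> :: real
  assumes "\<epsilon> > 0" and "\<zeta> > 0"
  shows "\<exists>\<eta>::real. \<exists>J::nat. \<eta> > 0 \<and>
    (\<forall>p\<in>{\<zeta>..1 - \<zeta>}. \<forall>\<rho>\<in>{\<zeta>..1 - \<zeta>}. \<forall>lam\<in>{\<zeta>..1}.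
      \<forall>(n::nat) (f :: (nat \<Rightarrow> bool) \<Rightarrow> real) (g :: (nat \<Rightarrow> bool) \<Rightarrow> bool).
        (\<forall>x\<in>cube n. f x \<in> {0..1}) \<longrightarrow>
        one_sided_error_solutions n p \<rho> lam \<eta> f g \<longrightarrow>
        (\<exists>h :: (nat \<Rightarrow> bool) \<Rightarrow> bool.
           mono_on (cube n) h \<and> depends_on_at_most n J h \<and> close n p \<epsilon> g h))"
proof -
  show ?thesis
    using one_sided_error_solutions_near_monotone_junta[OF assms, where 'a = nat]
  proof (elim exE conjE, goal_cases)
    case (1 \<eta> N)
    note core = 1(2)[rule_format]
    show ?case
    proof (intro exI[of _ \<eta>] exI[of _ N] conjI 1(1) ballI allI impI)
      fix p \<rho> lam :: real and n :: nat and f :: "(nat \<Rightarrow> bool) \<Rightarrow> real" and g :: "(nat \<Rightarrow> bool) \<Rightarrow> bool"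
      assume p: "p \<in> {\<zeta>..1 - \<zeta>}" and \<rho>: "\<rho> \<in> {\<zeta>..1 - \<zeta>}" and lam: "lam \<in> {\<zeta>..1}"
        and f: "\<forall>x\<in>cube n. f x \<in> {0..1}" and sol: "one_sided_error_solutions n p \<rho> lam \<eta> f g"
      \<comment> \<open>\<open>f\<close> is controlled on the cube only; \<open>f'\<close> agrees
        with it there and has values in the unit interval everywhere.\<close>
      define f' where "f' = (\<lambda>x. f (\<lambda>i. i < n \<and> x i))"
      let ?o = "\<lambda>_::nat. False"
      have p01: "0 \<le> p" "p \<le> 1" and \<rho>01: "0 \<le> \<rho>" "\<rho> \<le> 1" using p \<rho> assms by auto
      have ex: "measure_pmf.expectation (biased n q) F = avg q {..<n} F ?o" if "0 \<le> q" "q \<le> 1" for q F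
        unfolding biased_def using that by (intro expectation_Pi_pmf_bernoulli) auto
      have pr: "measure_pmf.prob (biased n p) {x. Q x} = avg p {..<n} (\<lambda>x. of_bool (Q x)) ?o" for Q
      proof -
        have "measure_pmf.prob (biased n p) {x. Q x} = measure_pmf.expectation (biased n p) (indicator {x. Q x})"
          by simp
        also have "\<dots> = avg p {..<n} (indicator {x. Q x}) ?o"
          using ex p01 by blast
        also have "indicator {x. Q x} = (\<lambda>x. of_bool (Q x) :: real)"
          by (auto simp: fun_eq_iff indicator_def)
        finally show ?thesis .
      qed
      \<comment> \<open>For \<open>x\<close> in the cube the AND is \<open>False\<close> from
        \<open>n\<close> on, so neither the truncation in \<open>f'\<close> nor the restriction to
        \<open>{..<n}\<close> changes anything.\<close>
      have T: "and_op n \<rho> f x = thin \<rho> {..<n} f' x" if "\<forall>i\<ge>n. \<not> x i" for x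
      proof -
        have "i < n" if "x i" for i
          using that \<open>\<forall>i\<ge>n. \<not> x i\<close> not_less by blast
        then have "(\<lambda>z. f (\<lambda>i. x i \<and> z i)) = (\<lambda>z. f' (\<lambda>i. x i \<and> (i \<in> {..<n} \<longrightarrow> z i)))"
          by (auto simp: f'_def fun_eq_iff intro!: arg_cong[of _ _ f])
        then show ?thesis
          unfolding and_op_def ex[OF \<rho>01] using avg_and_eq_thin[of "{..<n}" \<rho> f' x ?o] by simp
      qed
      have "\<exists>h J. J \<subseteq> {..<n} \<and> card J \<le> N \<and> mono h \<and> (\<forall>x y. (\<forall>i\<in>J. x i = y i) \<longrightarrow> h x = h y)
           \<and> avg p {..<n} (\<lambda>x. of_bool (g x \<noteq> h x)) ?o \<le> \<epsilon>"
      proof (rule core[OF p \<rho>])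
        show "\<zeta> \<le> lam" using lam by simp
        show "f' x \<in> {0..1}" for x using f by (auto simp: f'_def cube_def)
        have "avg p {..<n} (\<lambda>x. (1 - of_bool (g x)) * thin \<rho> {..<n} f' x) ?o
            = avg p {..<n} (\<lambda>x. (1 - of_bool (g x)) * and_op n \<rho> f x) ?o"
          by (intro avg_cong_outside) (auto simp: T not_less)
        then show "avg p {..<n} (\<lambda>x. (1 - of_bool (g x)) * thin \<rho> {..<n} f' x) ?o \<le> \<eta>"
          using sol by (simp add: one_sided_error_solutions_def ex[OF p01])
        have "avg p {..<n} (\<lambda>x. of_bool (g x \<and> thin \<rho> {..<n} f' x \<le> lam)) ?o
            = avg p {..<n} (\<lambda>x. of_bool (g x \<and> and_op n \<rho> f x \<le> lam)) ?o"
          by (intro avg_cong_outside) (auto simp: T not_less)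
        then show "avg p {..<n} (\<lambda>x. of_bool (g x \<and> thin \<rho> {..<n} f' x \<le> lam)) ?o \<le> \<eta>"
          using sol by (simp add: one_sided_error_solutions_def pr)
      qed simp
      then obtain h J where h: "J \<subseteq> {..<n}" "card J \<le> N" "mono h"
          "\<forall>x y. (\<forall>i\<in>J. x i = y i) \<longrightarrow> h x = h y"
          "avg p {..<n} (\<lambda>x. of_bool (g x \<noteq> h x)) ?o \<le> \<epsilon>" by blast
      show "\<exists>h. mono_on (cube n) h \<and> depends_on_at_most n N h \<and> close n p \<epsilon> g h"
      proof (intro exI[of _ h] conjI)
        show "mono_on (cube n) h" using h(3) by (rule mono_on_subset) simp
        show "depends_on_at_most n N h" unfolding depends_on_at_most_def using h(1,2,4) by blast
        show "close n p \<epsilon> g h" unfolding close_def pr using h(5) .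
      qed
    qed
  qed
qed

end
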